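(* Let $n\geq2$ and let $M$ be a group. Define the alphabet $X_1=\{e_{ij;a}: i,j\in\{1,\ldots,n\},\ i\neq j,\ a\in M\}$, write $e_{ij}=e_{ij;1}$, and let $\phi_1:X_1^+\to M\wr\mathrm{Sing}_n$ be the homomorphism with $e_{ij;a}\phi_1=\varepsilon_{ij;a}$. Let $R_1'$ be the following set of relations over $X_1$, where $a,b$ range over all elements of $M$ and $i,j,k,l$ over all distinct elements of $\{1,\ldots,n\}$ (as many as occur in the given relation): - $e_{ij;a}e_{ij;b}=e_{ij;a}=e_{ji;a^{-1}}e_{ij;a}$; - $e_{ij;1}e_{ji;a}e_{ij;b}=e_{ji;1}e_{ij;ab}$; - $e_{ij;a}e_{kl;b}=e_{kl;b}e_{ij;a}$; - $e_{ik;a}e_{jk;b}=e_{ik;a}$; - $e_{ij;1}e_{jk;a}e_{kj;1}=e_{ji;1}e_{ik;a}e_{ki;1}e_{ij;1}$; - $e_{ij;1}e_{ji;a}e_{ik;b}=e_{ji;1}e_{ik;b}e_{kj;a}e_{jk;1}$; - $e_{ij;b}e_{ik;ab}=e_{ik;ab}e_{ij;b}=e_{jk;a}e_{ij;b}$; - $e_{ki}e_{ij}e_{jk}=e_{ik}e_{kj}e_{ji}e_{ik}$; - $e_{ki}e_{ij}e_{jk}e_{kl}=e_{ik}e_{kl}e_{li}e_{ij}e_{jl}$. Then $M\wr\mathrm{Sing}_n$ has semigroup presentation $\langle X_1:R_1'\rangle$ via $\phi_1$.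
   Context: Maps are written on the right and composed from left to right. $\mathcal T_n$ is the monoid of all maps $\{1,\ldots,n\}\to\{1,\ldots,n\}$, and $\mathrm{Sing}_n$ is its subsemigroup of all non-bijective maps. The wreath product $M\wr\mathrm{Sing}_n$ is the set $M^n\times\mathrm{Sing}_n$ with product $$((a_1,\ldots,a_n),\alpha)((b_1,\ldots,b_n),\beta)=((a_1b_{1\alpha},\ldots,a_nb_{n\alpha}),\alpha\beta).$$ For distinct $i,j\in\{1,\ldots,n\}$, $\varepsilon_{ij}\in\mathrm{Sing}_n$ is the map with $j\varepsilon_{ij}=i$ and $k\varepsilon_{ij}=k$ for $k\neq j$. For $a\in M$, $\varepsilon_{ij;a}=(\mathbf a,\varepsilon_{ij})\in M\wr\mathrm{Sing}_n$, where $\mathbf a=(a_1,\ldots,a_n)$ has $a_j=a$ and $a_k=1$ for $k\neq j$. In a letter such as $e_{ij;ab}$ of $X_1$, the single monoid subscript is the product $ab$ in $M$. For an alphabet $X$, $X^+$ is the free semigroup on $X$. A relation $u=v$ stands for the pair $(u,v)\in X^+\times X^+$ (a chain $u=v=w$ stands for $u=v$ and $v=w$), and $R^\sharp$ is the congruence on $X^+$ generated by a set $R$ of relations. A semigroup $T$ has semigroup presentation $\langle X:R\rangle$ via $\phi:X^+\to T$ if $\phi$ is a surjective homomorphism with kernel $\{(u,v):u\phi=v\phi\}=R^\sharp$. *)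

theory Defs
  imports "HOL-Algebra.Group" "HOL-Library.FuncSet"
begin

text \<open>
  Semigroups are represented by monoid records, so that \<open>hom\<close> and \<open>epi\<close> can be used.
  These constants look only at the carrier and the multiplication. The field \<open>one\<close> plays
  no role anywhere below; it is set to \<open>undefined\<close>.
\<close>

definition semigroup_str :: "('a, 'b) monoid_scheme \<Rightarrow> bool" where
  "semigroup_str T \<longleftrightarrow>
     (\<forall>x\<in>carrier T. \<forall>y\<in>carrier T. x \<otimes>\<^bsub>T\<^esub> y \<in> carrier T) \<and>
     (\<forall>x\<in>carrier T. \<forall>y\<in>carrier T. \<forall>z\<in>carrier T.
        (x \<otimes>\<^bsub>T\<^esub> y) \<otimes>\<^bsub>T\<^esub> z = x \<otimes>\<^bsub>T\<^esub> (y \<otimes>\<^bsub>T\<^esub> z))"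

definition free_semigroup :: "'x set \<Rightarrow> 'x list monoid" where
  "free_semigroup X = \<lparr>carrier = lists X - {[]}, mult = (@), one = undefined\<rparr>"

definition congruence :: "('a, 'b) monoid_scheme \<Rightarrow> ('a \<times> 'a) set \<Rightarrow> bool" where
  "congruence T \<rho> \<longleftrightarrow> equiv (carrier T) \<rho> \<and>
     (\<forall>(u, v)\<in>\<rho>. \<forall>w\<in>carrier T.
        (w \<otimes>\<^bsub>T\<^esub> u, w \<otimes>\<^bsub>T\<^esub> v) \<in> \<rho> \<and> (u \<otimes>\<^bsub>T\<^esub> w, v \<otimes>\<^bsub>T\<^esub> w) \<in> \<rho>)"

definition cong_generated ::
    "('a, 'b) monoid_scheme \<Rightarrow> ('a \<times> 'a) set \<Rightarrow> ('a \<times> 'a) set" where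
  "cong_generated T R = \<Inter>{\<rho>. congruence T \<rho> \<and> R \<subseteq> \<rho>}"

definition hom_kernel :: "('a, 'b) monoid_scheme \<Rightarrow> ('a \<Rightarrow> 'c) \<Rightarrow> ('a \<times> 'a) set" where
  "hom_kernel T \<phi> = {(u, v). u \<in> carrier T \<and> v \<in> carrier T \<and> \<phi> u = \<phi> v}"

definition has_semigroup_presentation ::
    "('a, 'b) monoid_scheme \<Rightarrow> 'x set \<Rightarrow> ('x list \<times> 'x list) set \<Rightarrow> ('x list \<Rightarrow> 'a) \<Rightarrow> bool" where
  "has_semigroup_presentation T X R \<phi> \<longleftrightarrow>
     semigroup_str T \<and>
     R \<subseteq> carrier (free_semigroup X) \<times> carrier (free_semigroup X) \<and>
     \<phi> \<in> epi (free_semigroup X) T \<and>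
     hom_kernel (free_semigroup X) \<phi> = cong_generated (free_semigroup X) R"

text \<open>
  The extension to nonempty words of a map \<open>f\<close> from letters to a semigroup. The value at
  the empty word, which is not an element of the free semigroup, is left unspecified.
\<close>

fun word_extension :: "('a, 'b) monoid_scheme \<Rightarrow> ('x \<Rightarrow> 'a) \<Rightarrow> 'x list \<Rightarrow> 'a" where
  "word_extension T f [x] = f x"
| "word_extension T f (x # y # w) = f x \<otimes>\<^bsub>T\<^esub> word_extension T f (y # w)"

text \<open>
  Maps on \<open>{1..n}\<close> and tuples indexed by \<open>{1..n}\<close> are extensional functions, so that equality
  of functions is equality on \<open>{1..n}\<close>. Since maps act on the right, the product
  \<open>\<alpha>\<beta>\<close> (first \<open>\<alpha>\<close>, then \<open>\<beta>\<close>) is \<open>compose {1..n} \<beta> \<alpha>\<close>.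
\<close>

definition full_transf :: "nat \<Rightarrow> (nat \<Rightarrow> nat) set" where
  "full_transf n = {1..n} \<rightarrow>\<^sub>E {1..n}"

definition Sing :: "nat \<Rightarrow> (nat \<Rightarrow> nat) set" where
  "Sing n = {\<alpha> \<in> full_transf n. \<not> bij_betw \<alpha> {1..n} {1..n}}"

definition wreath_Sing ::
    "('m, 'b) monoid_scheme \<Rightarrow> nat \<Rightarrow> ((nat \<Rightarrow> 'm) \<times> (nat \<Rightarrow> nat)) monoid" where
  "wreath_Sing M n =
     \<lparr>carrier = ({1..n} \<rightarrow>\<^sub>E carrier M) \<times> Sing n,
      mult = (\<lambda>(a, \<alpha>) (b, \<beta>). (\<lambda>k\<in>{1..n}. a k \<otimes>\<^bsub>M\<^esub> b (\<alpha> k), compose {1..n} \<beta> \<alpha>)),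
      one = undefined\<rparr>"

definition eps_map :: "nat \<Rightarrow> nat \<Rightarrow> nat \<Rightarrow> nat \<Rightarrow> nat" where
  "eps_map n i j = (\<lambda>k\<in>{1..n}. if k = j then i else k)"

definition eps ::
    "('m, 'b) monoid_scheme \<Rightarrow> nat \<Rightarrow> nat \<Rightarrow> nat \<Rightarrow> 'm \<Rightarrow> (nat \<Rightarrow> 'm) \<times> (nat \<Rightarrow> nat)" where
  "eps M n i j a = (\<lambda>k\<in>{1..n}. if k = j then a else \<one>\<^bsub>M\<^esub>, eps_map n i j)"

text \<open>The letter \<open>E i j a\<close> stands for \<open>e\<^sub>i\<^sub>j\<^sub>;\<^sub>a\<close>.\<close>

datatype 'm letter = E nat nat 'm

definition X1 :: "('m, 'b) monoid_scheme \<Rightarrow> nat \<Rightarrow> 'm letter set" where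
  "X1 M n = {E i j a | i j a. i \<in> {1..n} \<and> j \<in> {1..n} \<and> i \<noteq> j \<and> a \<in> carrier M}"

definition phi1 ::
    "('m, 'b) monoid_scheme \<Rightarrow> nat \<Rightarrow> 'm letter list \<Rightarrow> (nat \<Rightarrow> 'm) \<times> (nat \<Rightarrow> nat)" where
  "phi1 M n = word_extension (wreath_Sing M n) (\<lambda>x. case x of E i j a \<Rightarrow> eps M n i j a)"

definition distinct_in :: "nat \<Rightarrow> nat list \<Rightarrow> bool" where
  "distinct_in n is \<longleftrightarrow> distinct is \<and> set is \<subseteq> {1..n}"

text \<open>A chain \<open>u = v = w\<close> contributes the two pairs \<open>(u, v)\<close> and \<open>(v, w)\<close>.\<close>

inductive_set R1' :: "('m, 'b) monoid_scheme \<Rightarrow> nat \<Rightarrow> ('m letter list \<times> 'm letter list) set"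
  for M (structure) and n where
  idem:
    "\<lbrakk>distinct_in n [i, j]; a \<in> carrier M; b \<in> carrier M\<rbrakk> \<Longrightarrow>
     ([E i j a, E i j b], [E i j a]) \<in> R1' M n"
| inv_idem:
    "\<lbrakk>distinct_in n [i, j]; a \<in> carrier M\<rbrakk> \<Longrightarrow>
     ([E i j a], [E j i (inv a), E i j a]) \<in> R1' M n"
| two_index:
    "\<lbrakk>distinct_in n [i, j]; a \<in> carrier M; b \<in> carrier M\<rbrakk> \<Longrightarrow>
     ([E i j \<one>, E j i a, E i j b], [E j i \<one>, E i j (a \<otimes> b)]) \<in> R1' M n"
| commute:
    "\<lbrakk>distinct_in n [i, j, k, l]; a \<in> carrier M; b \<in> carrier M\<rbrakk> \<Longrightarrow>
     ([E i j a, E k l b], [E k l b, E i j a]) \<in> R1' M n"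
| absorb:
    "\<lbrakk>distinct_in n [i, j, k]; a \<in> carrier M; b \<in> carrier M\<rbrakk> \<Longrightarrow>
     ([E i k a, E j k b], [E i k a]) \<in> R1' M n"
| transport:
    "\<lbrakk>distinct_in n [i, j, k]; a \<in> carrier M\<rbrakk> \<Longrightarrow>
     ([E i j \<one>, E j k a, E k j \<one>], [E j i \<one>, E i k a, E k i \<one>, E i j \<one>]) \<in> R1' M n"
| exchange:
    "\<lbrakk>distinct_in n [i, j, k]; a \<in> carrier M; b \<in> carrier M\<rbrakk> \<Longrightarrow>
     ([E i j \<one>, E j i a, E i k b], [E j i \<one>, E i k b, E k j a, E j k \<one>]) \<in> R1' M n"
| triangle1:
    "\<lbrakk>distinct_in n [i, j, k]; a \<in> carrier M; b \<in> carrier M\<rbrakk> \<Longrightarrow>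
     ([E i j b, E i k (a \<otimes> b)], [E i k (a \<otimes> b), E i j b]) \<in> R1' M n"
| triangle2:
    "\<lbrakk>distinct_in n [i, j, k]; a \<in> carrier M; b \<in> carrier M\<rbrakk> \<Longrightarrow>
     ([E i k (a \<otimes> b), E i j b], [E j k a, E i j b]) \<in> R1' M n"
| cycle3:
    "distinct_in n [i, j, k] \<Longrightarrow>
     ([E k i \<one>, E i j \<one>, E j k \<one>], [E i k \<one>, E k j \<one>, E j i \<one>, E i k \<one>]) \<in> R1' M n"
| cycle4:
    "distinct_in n [i, j, k, l] \<Longrightarrow>
     ([E k i \<one>, E i j \<one>, E j k \<one>, E k l \<one>],
      [E i k \<one>, E k l \<one>, E l i \<one>, E i j \<one>, E j l \<one>]) \<in> R1' M n"

end

(*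
  A word acts on the positions 1..n as a process that moves M-labelled tokens. A letter e_ij;a
  leaves position j empty; from then on each letter either does nothing, or moves a token into the
  tracked hole, or merges two tokens. Every merge can be pushed to the left past the moves, so
  each word equals a star (letters e_ij;a whose sources i are not among their distinct targets j),
  which encodes the kernel, followed by a path of the hole. A closed path acts by swaps and
  relabellings of the remaining tokens; these satisfy the relations of a wreath product with a
  symmetric group presented by all transpositions, and peeling off one token at a time shows that
  a closed path fixing all tokens is trivial after the star. Finally, a word absorbs on its left
  every star letter compatible with its kernel, so two words with the same image can be given the
  same star.
*)
theory Submission
  imports Defs
begin

text \<open>Whether a position is empty depends on what precedes a letter, so words are compared
  through the states they lead to, and a hole at \<open>h\<close> is the fixed-point equation
  \<open>S \<rhd> E i h a = S\<close>. Each longer relation has a side that begins with a letter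
  aimed at the hole, once the hole is given the right index. Absorbing that letter,
  \<open>two_index\<close> lets a label slide along a move, \<open>transport\<close> makes
  relabelling independent of where the hole waits, \<open>exchange\<close> makes relabellings of
  different tokens commute, \<open>cycle3\<close> makes swaps symmetric, and \<open>cycle4\<close>
  makes them independent of where the hole waits. The other rules for swaps follow by taking the
  hole to a convenient place. Inverses in \<open>M\<close> make every move into a hole reversible.
  Two obstacles remain. A kernel class may be collapsed onto any of its members, so stars are not
  unique and two normal forms cannot be compared directly. And a star may open several holes while a
  path tracks only one, so the others must be shown harmless.\<close>

section \<open>Generated congruences on free semigroups\<close>

lemma cong_generated_superset: "R \<subseteq> cong_generated T R"
  by (auto simp: cong_generated_def)

lemma cong_generated_least: "congruence T \<rho> \<Longrightarrow> R \<subseteq> \<rho> \<Longrightarrow> cong_generated T R \<subseteq> \<rho>"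
  by (auto simp: cong_generated_def)

lemma congruence_cong_generated:
  assumes T: "semigroup_str T" and R: "R \<subseteq> carrier T \<times> carrier T"
  shows "congruence T (cong_generated T R)"
proof -
  let ?C = "{\<rho>. congruence T \<rho> \<and> R \<subseteq> \<rho>}"
  \<comment> \<open>The family is nonempty; an empty intersection would contain pairs outside the
    carrier.\<close>
  have full: "carrier T \<times> carrier T \<in> ?C"
    using T R by (auto simp: congruence_def semigroup_str_def equiv_def refl_on_def sym_def trans_def)
  have eq: "equiv (carrier T) (\<Inter>?C)"
  proof (rule equivI)
    show "\<Inter>?C \<subseteq> carrier T \<times> carrier T"
      using full by blast
    show "refl_on (carrier T) (\<Inter>?C)"
      by (auto simp: congruence_def equiv_def refl_on_def)
    show "sym (\<Inter>?C)"
    proof (rule symI, rule InterI)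
      fix u v \<rho> assume "(u, v) \<in> \<Inter>?C" "\<rho> \<in> ?C"
      then have "(u, v) \<in> \<rho>" "sym \<rho>"
        by (auto simp: congruence_def equiv_def)
      then show "(v, u) \<in> \<rho>"
        by (blast dest: symD)
    qed
    show "trans (\<Inter>?C)"
    proof (rule transI, rule InterI)
      fix u v w \<rho> assume "(u, v) \<in> \<Inter>?C" "(v, w) \<in> \<Inter>?C" "\<rho> \<in> ?C"
      then have "(u, v) \<in> \<rho>" "(v, w) \<in> \<rho>" "trans \<rho>"
        by (auto simp: congruence_def equiv_def)
      then show "(u, w) \<in> \<rho>"
        by (blast dest: transD)
    qed
  qed
  have "(w \<otimes>\<^bsub>T\<^esub> u, w \<otimes>\<^bsub>T\<^esub> v) \<in> \<Inter>?C \<and> (u \<otimes>\<^bsub>T\<^esub> w, v \<otimes>\<^bsub>T\<^esub> w) \<in> \<Inter>?C"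
    if "(u, v) \<in> \<Inter>?C" "w \<in> carrier T" for u v w
  proof -
    have "(w \<otimes>\<^bsub>T\<^esub> u, w \<otimes>\<^bsub>T\<^esub> v) \<in> \<rho> \<and> (u \<otimes>\<^bsub>T\<^esub> w, v \<otimes>\<^bsub>T\<^esub> w) \<in> \<rho>" if \<rho>: "\<rho> \<in> ?C" for \<rho>
    proof -
      have "(u, v) \<in> \<rho>" using \<open>(u, v) \<in> \<Inter>?C\<close> \<rho> by blast
      then show ?thesis using \<rho> \<open>w \<in> carrier T\<close> unfolding congruence_def by blast
    qed
    then show ?thesis by blast
  qed
  then show ?thesis
    using eq by (auto simp: congruence_def cong_generated_def)
qed

lemma semigroup_free_semigroup: "semigroup_str (free_semigroup X)"
  by (auto simp: semigroup_str_def free_semigroup_def)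

text \<open>The free semigroup has no identity, so an empty context \<open>p\<close> or
  \<open>q\<close> is not covered by the definition of a congruence and is split off.\<close>

lemma congruence_free_semigroup_append:
  assumes "congruence (free_semigroup X) \<rho>" and "(u, v) \<in> \<rho>" and "p \<in> lists X" and "q \<in> lists X"
  shows "(p @ u @ q, p @ v @ q) \<in> \<rho>"
proof -
  have *: "(u @ q, v @ q) \<in> \<rho>"
    using assms by (cases "q = []") (auto simp: congruence_def free_semigroup_def)
  then show ?thesis
    using assms by (cases "p = []") (auto simp: congruence_def free_semigroup_def)
qed

fun src :: "'m letter \<Rightarrow> nat" where "src (E i j a) = i"

fun tgt :: "'m letter \<Rightarrow> nat" where "tgt (E i j a) = j"

locale wreath = group M for M :: "('m, 'b) monoid_scheme" (structure) +
  fixes n :: nat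
begin

definition I :: "nat set" where "I = {1..n}"

lemma finite_I [simp]: "finite I"
  by (simp add: I_def)

abbreviation X :: "'m letter set" where "X \<equiv> X1 M n"

abbreviation cong_rel :: "('m letter list \<times> 'm letter list) set" where
  "cong_rel \<equiv> cong_generated (free_semigroup X) (R1' M n)"

lemma E_in_X [simp]: "E i j a \<in> X \<longleftrightarrow> i \<in> I \<and> j \<in> I \<and> i \<noteq> j \<and> a \<in> carrier M"
  by (auto simp: X1_def I_def)

lemma carrier_free_semigroup: "carrier (free_semigroup Y) = lists Y - {[]}"
  by (simp add: free_semigroup_def)

lemma distinct_in_iff: "distinct_in n is \<longleftrightarrow> distinct is \<and> set is \<subseteq> I"
  by (simp add: distinct_in_def I_def)

lemma R1'_lists: "(u, v) \<in> R1' M n \<Longrightarrow> u \<in> lists X - {[]} \<and> v \<in> lists X - {[]}"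
  by (erule R1'.cases) (simp_all add: distinct_in_iff)

lemma R1'_subset: "R1' M n \<subseteq> carrier (free_semigroup X) \<times> carrier (free_semigroup X)"
  using R1'_lists by (auto simp: carrier_free_semigroup)

lemma congruence_cong_rel: "congruence (free_semigroup X) cong_rel"
  by (rule congruence_cong_generated[OF semigroup_free_semigroup R1'_subset])

lemma cong_rel_equiv: "equiv (lists X - {[]}) cong_rel"
  using congruence_cong_rel by (simp add: congruence_def free_semigroup_def)

subsection \<open>The faithful action on labelled positions\<close>

text \<open>\<open>pos\<close> and \<open>lab\<close> are the components of \<open>phi1\<close>
  before restriction to \<open>I\<close>. They also make sense for the empty word, so contexts and
  inductions need no nonemptiness condition.\<close>

fun pos :: "'m letter list \<Rightarrow> nat \<Rightarrow> nat" where
  "pos [] k = k"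
| "pos (E i j a # w) k = pos w (if k = j then i else k)"

fun lab :: "'m letter list \<Rightarrow> nat \<Rightarrow> 'm" where
  "lab [] k = \<one>"
| "lab (E i j a # w) k = (if k = j then a \<otimes> lab w i else lab w k)"

lemma pos_append [simp]: "pos (u @ v) k = pos v (pos u k)"
  by (induction u k rule: pos.induct) auto

lemma lab_closed [simp]: "w \<in> lists X \<Longrightarrow> lab w k \<in> carrier M"
  by (induction w k rule: lab.induct) auto

lemma pos_closed [simp]: "w \<in> lists X \<Longrightarrow> pos w k \<in> I \<longleftrightarrow> k \<in> I"
  by (induction w k rule: pos.induct) auto

lemma lab_append [simp]:
  "u \<in> lists X \<Longrightarrow> v \<in> lists X \<Longrightarrow> lab (u @ v) k = lab u k \<otimes> lab v (pos u k)"
  by (induction u k rule: lab.induct) (auto simp: m_assoc)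

definition act_eq :: "'m letter list \<Rightarrow> 'm letter list \<Rightarrow> bool" where
  "act_eq u v \<longleftrightarrow> (\<forall>k\<in>I. pos u k = pos v k \<and> lab u k = lab v k)"

lemma act_eqD: "act_eq u v \<Longrightarrow> k \<in> I \<Longrightarrow> pos u k = pos v k \<and> lab u k = lab v k"
  by (simp add: act_eq_def)

lemma act_eq_trans: "act_eq u v \<Longrightarrow> act_eq v w \<Longrightarrow> act_eq u w"
  by (simp add: act_eq_def)

lemma act_eq_sym: "act_eq u v \<Longrightarrow> act_eq v u"
  by (simp add: act_eq_def)

lemma act_eq_R1': "(u, v) \<in> R1' M n \<Longrightarrow> act_eq u v"
  by (erule R1'.cases) (auto simp: act_eq_def distinct_in_iff m_assoc)

lemma phi1_eq:
  assumes "w \<in> lists X" "w \<noteq> []"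
  shows "phi1 M n w = (restrict (lab w) I, restrict (pos w) I)"
  using assms
proof (induction w rule: list.induct)
  case (Cons x w)
  obtain i j a where x: "x = E i j a" by (cases x)
  show ?case
  proof (cases w)
    case Nil
    moreover have "E i j a \<in> X" using Cons.prems x by simp
    ultimately show ?thesis
      by (auto simp: x phi1_def eps_def eps_map_def fun_eq_iff I_def)
  next
    case (Cons y w')
    then have IH: "phi1 M n w = (restrict (lab w) I, restrict (pos w) I)"
      using Cons.IH Cons.prems by auto
    have "phi1 M n (x # w) = eps M n i j a \<otimes>\<^bsub>wreath_Sing M n\<^esub> phi1 M n w"
      by (simp add: phi1_def Cons x)
    also have "\<dots> = (restrict (lab (x # w)) I, restrict (pos (x # w)) I)"
      unfolding IH using \<open>x # w \<in> lists X\<close>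
      by (auto simp: x eps_def eps_map_def wreath_Sing_def compose_def fun_eq_iff I_def)
    finally show ?thesis .
  qed
qed simp

lemma phi1_eq_iff:
  assumes "u \<in> lists X - {[]}" "v \<in> lists X - {[]}"
  shows "phi1 M n u = phi1 M n v \<longleftrightarrow> act_eq u v"
  using assms by (auto simp: phi1_eq act_eq_def fun_eq_iff restrict_def)

lemma act_eq_append:
  assumes "act_eq u v" "u \<in> lists X" "v \<in> lists X" "p \<in> lists X" "q \<in> lists X"
  shows "act_eq (p @ u @ q) (p @ v @ q)"
  using assms by (auto simp: act_eq_def)

lemma congruence_hom_kernel:
  "congruence (free_semigroup X) (hom_kernel (free_semigroup X) (phi1 M n))"
proof -
  have K: "hom_kernel (free_semigroup X) (phi1 M n) =
      {(u, v). u \<in> lists X - {[]} \<and> v \<in> lists X - {[]} \<and> act_eq u v}"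
    using phi1_eq_iff by (auto simp: hom_kernel_def free_semigroup_def)
  have "act_eq (w @ u) (w @ v)" "act_eq (u @ w) (v @ w)"
    if "act_eq u v" "u \<in> lists X" "v \<in> lists X" "w \<in> lists X" for u v w
    using act_eq_append[OF that(1-3), of w "[]"] act_eq_append[OF that(1-3), of "[]" w] that(4)
    by auto
  then show ?thesis
    unfolding K congruence_def equiv_def
    by (auto simp: free_semigroup_def refl_on_def sym_def trans_def act_eq_def)
qed

lemma cong_rel_sound: "cong_rel \<subseteq> hom_kernel (free_semigroup X) (phi1 M n)"
proof (rule cong_generated_least[OF congruence_hom_kernel], clarify)
  fix u v assume uv: "(u, v) \<in> R1' M n"
  then have "u \<in> lists X - {[]}" "v \<in> lists X - {[]}"
    using R1'_subset by (auto simp: free_semigroup_def)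
  then show "(u, v) \<in> hom_kernel (free_semigroup X) (phi1 M n)"
    using act_eq_R1'[OF uv] phi1_eq_iff[of u v] by (simp add: hom_kernel_def free_semigroup_def)
qed

subsection \<open>States\<close>

text \<open>
  Equality of words modulo the relations is tested on states, so that a relation becomes an honest
  equation that rewrites any prefix of a chain of steps.
\<close>

definition step :: "'m letter list set \<Rightarrow> 'm letter \<Rightarrow> 'm letter list set" (infixl "\<rhd>" 65) where
  "S \<rhd> x = {v. \<exists>u\<in>S. (u @ [x], v) \<in> cong_rel}"

definition run :: "'m letter list set \<Rightarrow> 'm letter list \<Rightarrow> 'm letter list set" where
  "run S w = foldl step S w"

lemma run_simps [simp]:
  "run S [] = S" "run S (x # w) = run (step S x) w" "run S (u @ v) = run (run S u) v"
  by (simp_all add: run_def)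

lemma cong_rel_carrier: "(u, v) \<in> cong_rel \<Longrightarrow> u \<in> lists X - {[]} \<and> v \<in> lists X - {[]}"
  using cong_rel_equiv by (auto simp: equiv_def)

text \<open>Each step closes under the congruence; transitivity merges these closures into one. The
  empty word closes nothing, hence the hypothesis.\<close>

lemma run_eq: "w \<noteq> [] \<Longrightarrow> run S w = {v. \<exists>u\<in>S. (u @ w, v) \<in> cong_rel}"
proof (induction w rule: rev_induct)
  case (snoc x w)
  show ?case
  proof (cases "w = []")
    case True
    then show ?thesis by (simp add: step_def)
  next
    case False
    have "run S (w @ [x]) = {v. \<exists>u\<in>S. \<exists>t. (u @ w, t) \<in> cong_rel \<and> (t @ [x], v) \<in> cong_rel}"
      using snoc.IH[OF False] by (auto simp: step_def)
    also have "\<dots> = {v. \<exists>u\<in>S. (u @ w @ [x], v) \<in> cong_rel}"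
    proof (intro Collect_cong bex_cong refl iffI)
      fix v u
      assume "\<exists>t. (u @ w, t) \<in> cong_rel \<and> (t @ [x], v) \<in> cong_rel"
      then obtain t where t: "(u @ w, t) \<in> cong_rel" "(t @ [x], v) \<in> cong_rel" by blast
      then have "(u @ w @ [x], t @ [x]) \<in> cong_rel"
        using congruence_free_semigroup_append[OF congruence_cong_rel t(1), of "[]" "[x]"]
          cong_rel_carrier[OF t(2)] by auto
      then show "(u @ w @ [x], v) \<in> cong_rel"
        using t(2) cong_rel_equiv by (auto simp: equiv_def dest: transD)
    next
      fix v u
      assume *: "(u @ w @ [x], v) \<in> cong_rel"
      then have "u @ w \<in> lists X - {[]}"
        using cong_rel_carrier[OF *] False by auto
      then have "(u @ w, u @ w) \<in> cong_rel"
        using cong_rel_equiv by (auto simp: equiv_def refl_on_def)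
      then show "\<exists>t. (u @ w, t) \<in> cong_rel \<and> (t @ [x], v) \<in> cong_rel"
        using * by auto
    qed
    finally show ?thesis .
  qed
qed simp

text \<open>Quantifying over start states builds in left contexts, and right contexts come from
  running further, so compatibility with concatenation is immediate on unfolding.\<close>

definition run_eqv :: "'m letter list \<Rightarrow> 'm letter list \<Rightarrow> bool" (infix "\<approx>" 50) where
  "u \<approx> v \<longleftrightarrow> (\<forall>S. run S u = run S v)"

lemma run_eqvI: "(\<And>S. run S u = run S v) \<Longrightarrow> u \<approx> v"
  by (simp add: run_eqv_def)

lemma run_eqvD: "u \<approx> v \<Longrightarrow> run S u = run S v"
  by (simp add: run_eqv_def)

lemma run_eqv_cong_rel:
  assumes "u \<approx> v" "u \<in> lists X - {[]}" "v \<in> lists X - {[]}"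
  shows "(u, v) \<in> cong_rel"
proof -
  \<comment> \<open>The start state \<open>{[]}\<close> recovers the congruence class of the word
    itself.\<close>
  have "{t. (u, t) \<in> cong_rel} = {t. (v, t) \<in> cong_rel}"
    using run_eqvD[OF assms(1), of "{[]}"] assms(2,3) by (simp add: run_eq)
  moreover have "(v, v) \<in> cong_rel"
    using cong_rel_equiv assms(3) by (auto simp: equiv_def refl_on_def)
  ultimately show ?thesis by blast
qed

lemma run_eqv_act_eq:
  assumes "u \<approx> v" "u \<in> lists X - {[]}" "v \<in> lists X - {[]}"
  shows "act_eq u v"
  using run_eqv_cong_rel[OF assms] cong_rel_sound phi1_eq_iff[OF assms(2,3)]
  by (auto simp: hom_kernel_def)

lemma run_R1':
  assumes "(u, v) \<in> R1' M n"
  shows "run S u = run S v"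
proof -
  have "(u, v) \<in> cong_rel"
    using assms cong_generated_superset by blast
  then have uv: "(p @ u, p @ v) \<in> cong_rel" if "p \<in> lists X" for p
    using congruence_free_semigroup_append[OF congruence_cong_rel, of u v p "[]"] that by simp
  have "u \<noteq> []" "v \<noteq> []"
    using R1'_subset assms by (auto simp: free_semigroup_def)
  moreover have "(p @ u, t) \<in> cong_rel \<longleftrightarrow> (p @ v, t) \<in> cong_rel" for p t
  proof (cases "p \<in> lists X")
    case True
    show ?thesis
      using uv[OF True] cong_rel_equiv unfolding equiv_def by (meson symD transD)
  next
    case False
    then show ?thesis
      using cong_rel_carrier[of "p @ u" t] cong_rel_carrier[of "p @ v" t] by auto
  qed
  ultimately show ?thesis
    by (simp add: run_eq)
qed

section \<open>The defining relations as equations between states\<close>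

lemma rel_idem:
  "\<lbrakk>i \<in> I; j \<in> I; i \<noteq> j; a \<in> carrier M; b \<in> carrier M\<rbrakk> \<Longrightarrow>
    S \<rhd> E i j a \<rhd> E i j b = S \<rhd> E i j a"
  using run_R1'[OF R1'.idem[of n i j a M b], of S] by (simp add: distinct_in_iff)

lemma rel_inv:
  "\<lbrakk>i \<in> I; j \<in> I; i \<noteq> j; a \<in> carrier M\<rbrakk> \<Longrightarrow> S \<rhd> E j i (inv a) \<rhd> E i j a = S \<rhd> E i j a"
  using run_R1'[OF R1'.inv_idem[of n i j a M], of S] by (simp add: distinct_in_iff)

lemma rel_two_index:
  "\<lbrakk>i \<in> I; j \<in> I; i \<noteq> j; a \<in> carrier M; b \<in> carrier M\<rbrakk> \<Longrightarrow>
    S \<rhd> E i j \<one> \<rhd> E j i a \<rhd> E i j b = S \<rhd> E j i \<one> \<rhd> E i j (a \<otimes> b)"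
  using run_R1'[OF R1'.two_index[of n i j a M b], of S] by (simp add: distinct_in_iff)

lemma rel_commute:
  "\<lbrakk>i \<in> I; j \<in> I; k \<in> I; l \<in> I; distinct [i, j, k, l]; a \<in> carrier M; b \<in> carrier M\<rbrakk> \<Longrightarrow>
    S \<rhd> E i j a \<rhd> E k l b = S \<rhd> E k l b \<rhd> E i j a"
  using run_R1'[OF R1'.commute[of n i j k l a M b], of S] by (simp add: distinct_in_iff)

lemma rel_absorb:
  "\<lbrakk>i \<in> I; j \<in> I; k \<in> I; i \<noteq> k; j \<noteq> k; a \<in> carrier M; b \<in> carrier M\<rbrakk> \<Longrightarrow>
    S \<rhd> E i k a \<rhd> E j k b = S \<rhd> E i k a"
  using run_R1'[OF R1'.absorb[of n i j k a M b], of S] rel_idem[of i k a b S]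
  by (cases "i = j") (auto simp: distinct_in_iff)

lemma rel_transport:
  "\<lbrakk>i \<in> I; j \<in> I; k \<in> I; distinct [i, j, k]; a \<in> carrier M\<rbrakk> \<Longrightarrow>
    S \<rhd> E i j \<one> \<rhd> E j k a \<rhd> E k j \<one> = S \<rhd> E j i \<one> \<rhd> E i k a \<rhd> E k i \<one> \<rhd> E i j \<one>"
  using run_R1'[OF R1'.transport[of n i j k a M], of S] by (simp add: distinct_in_iff)

lemma rel_exchange:
  "\<lbrakk>i \<in> I; j \<in> I; k \<in> I; distinct [i, j, k]; a \<in> carrier M; b \<in> carrier M\<rbrakk> \<Longrightarrow>
    S \<rhd> E i j \<one> \<rhd> E j i a \<rhd> E i k b = S \<rhd> E j i \<one> \<rhd> E i k b \<rhd> E k j a \<rhd> E j k \<one>"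
  using run_R1'[OF R1'.exchange[of n i j k a M b], of S] by (simp add: distinct_in_iff)

text \<open>\<open>triangle1\<close> wants the second label in the form
  \<open>a \<otimes> b\<close>; in a group every \<open>c\<close> is
  \<open>(c \<otimes> inv b) \<otimes> b\<close>.\<close>

lemma rel_fork:
  "\<lbrakk>i \<in> I; j \<in> I; k \<in> I; distinct [i, j, k]; b \<in> carrier M; c \<in> carrier M\<rbrakk> \<Longrightarrow>
    S \<rhd> E i j b \<rhd> E i k c = S \<rhd> E i k c \<rhd> E i j b"
  using run_R1'[OF R1'.triangle1[of n i j k "c \<otimes> inv b" M b], of S]
  by (simp add: distinct_in_iff m_assoc)

lemma rel_chain:
  "\<lbrakk>i \<in> I; j \<in> I; k \<in> I; distinct [i, j, k]; a \<in> carrier M; b \<in> carrier M\<rbrakk> \<Longrightarrow>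
    S \<rhd> E j k a \<rhd> E i j b = S \<rhd> E i j b \<rhd> E i k (a \<otimes> b)"
  using run_R1'[OF R1'.triangle1[of n i j k a M b], of S]
    run_R1'[OF R1'.triangle2[of n i j k a M b], of S]
  by (simp add: distinct_in_iff)

lemma rel_cycle3:
  "\<lbrakk>i \<in> I; j \<in> I; k \<in> I; distinct [i, j, k]\<rbrakk> \<Longrightarrow>
    S \<rhd> E k i \<one> \<rhd> E i j \<one> \<rhd> E j k \<one> = S \<rhd> E i k \<one> \<rhd> E k j \<one> \<rhd> E j i \<one> \<rhd> E i k \<one>"
  using run_R1'[OF R1'.cycle3[of n i j k M], of S] by (simp add: distinct_in_iff)

lemma rel_cycle4:
  "\<lbrakk>i \<in> I; j \<in> I; k \<in> I; l \<in> I; distinct [i, j, k, l]\<rbrakk> \<Longrightarrow>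
    S \<rhd> E k i \<one> \<rhd> E i j \<one> \<rhd> E j k \<one> \<rhd> E k l \<one> =
    S \<rhd> E i k \<one> \<rhd> E k l \<one> \<rhd> E l i \<one> \<rhd> E i j \<one> \<rhd> E j l \<one>"
  using run_R1'[OF R1'.cycle4[of n i j k l M], of S] by (simp add: distinct_in_iff)

subsection \<open>Holes\<close>

text \<open>Think of a word as moving tokens: at a hole \<open>h\<close> there is no token left to be moved away.\<close>

definition hole :: "'m letter list set \<Rightarrow> nat \<Rightarrow> bool" where
  "hole S h \<longleftrightarrow> h \<in> I \<and> (\<exists>i\<in>I - {h}. \<exists>a\<in>carrier M. S \<rhd> E i h a = S)"

lemma hole_in_I: "hole S h \<Longrightarrow> h \<in> I"
  by (simp add: hole_def)

text \<open>One witness letter suffices for all: \<open>S\<close> equals its own image under that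
  letter, and a letter into \<open>h\<close> swallows any next letter into \<open>h\<close>.\<close>

lemma hole_absorb:
  "\<lbrakk>hole S h; i \<in> I; i \<noteq> h; a \<in> carrier M\<rbrakk> \<Longrightarrow> S \<rhd> E i h a = S"
  unfolding hole_def using rel_absorb by (metis DiffD1 DiffD2 singletonI)

lemma hole_new [simp]:
  "\<lbrakk>i \<in> I; j \<in> I; i \<noteq> j; a \<in> carrier M\<rbrakk> \<Longrightarrow> hole (S \<rhd> E i j a) j"
  unfolding hole_def using rel_idem by blast

text \<open>The witness shares the source \<open>p\<close> with the given letter, because letters
  with a common source commute.\<close>

lemma hole_keep:
  assumes "hole S h" "p \<in> I" "q \<in> I" "p \<noteq> q" "p \<noteq> h" "q \<noteq> h" "a \<in> carrier M"
  shows "hole (S \<rhd> E p q a) h"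
proof -
  note h = hole_in_I[OF assms(1)]
  have "S \<rhd> E p q a \<rhd> E p h \<one> = S \<rhd> E p h \<one> \<rhd> E p q a"
    using assms h by (intro rel_fork) auto
  also have "\<dots> = S \<rhd> E p q a"
    using assms by (simp add: hole_absorb)
  finally show ?thesis
    using assms h unfolding hole_def by blast
qed

text \<open>\<open>rel_inv\<close> reduces the round trip to the return letter alone, and that
  letter points into the hole of \<open>S\<close>.\<close>

lemma move_back:
  assumes "hole S h" "k \<in> I" "k \<noteq> h" "a \<in> carrier M"
  shows "S \<rhd> E h k a \<rhd> E k h (inv a) = S"
  using rel_inv[of k h "inv a" S] hole_absorb[OF assms(1), of k "inv a"] hole_in_I[OF assms(1)] assms
  by simp

lemma move_back_one [simp]:
  assumes "hole S h" "k \<in> I" "k \<noteq> h"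
  shows "S \<rhd> E h k \<one> \<rhd> E k h \<one> = S"
  using move_back[OF assms, of \<one>] by simp

lemma move_shift_label:
  assumes "hole S h" "k \<in> I" "k \<noteq> h" "a \<in> carrier M" "b \<in> carrier M"
  shows "S \<rhd> E h k a \<rhd> E k h b = S \<rhd> E h k \<one> \<rhd> E k h (a \<otimes> b)"
  using rel_two_index[of k h a b S] hole_absorb[OF assms(1), of k \<one>] hole_in_I[OF assms(1)] assms
  by simp

text \<open>
  Given a hole \<open>h\<close>, the contents of the other positions can be relabelled and permuted; the
  routes chosen here for doing so start and end with the hole at \<open>h\<close>.
\<close>

definition lb :: "nat \<Rightarrow> nat \<Rightarrow> 'm \<Rightarrow> 'm letter list set \<Rightarrow> 'm letter list set" where
  "lb h k a S = S \<rhd> E h k a \<rhd> E k h \<one>"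

definition sw :: "nat \<Rightarrow> nat \<Rightarrow> nat \<Rightarrow> 'm letter list set \<Rightarrow> 'm letter list set" where
  "sw h p q S = (if p = q then S else S \<rhd> E h p \<one> \<rhd> E p q \<one> \<rhd> E q h \<one>)"

lemma hole_lb [simp]: "\<lbrakk>h \<in> I; k \<in> I; k \<noteq> h; a \<in> carrier M\<rbrakk> \<Longrightarrow> hole (lb h k a S) h"
  by (simp add: lb_def)

lemma hole_sw [simp]: "\<lbrakk>hole S h; p \<in> I; q \<in> I; p \<noteq> h; q \<noteq> h\<rbrakk> \<Longrightarrow> hole (sw h p q S) h"
  by (simp add: sw_def hole_in_I)

lemma sw_refl [simp]: "sw h p p S = S"
  by (simp add: sw_def)

text \<open>This is \<open>rel_transport\<close> with its leading letter absorbed; the last move of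
  the other side then cancels.\<close>

lemma lb_move:
  assumes "hole S h" "k \<in> I" "l \<in> I" "distinct [h, k, l]" "a \<in> carrier M"
  shows "lb h k a S \<rhd> E h l \<one> = lb l k a (S \<rhd> E h l \<one>)"
proof -
  note h = hole_in_I[OF assms(1)]
  let ?T = "lb l k a (S \<rhd> E h l \<one>)"
  have "lb h k a S = ?T \<rhd> E l h \<one>"
    using rel_transport[of l h k a S] hole_absorb[OF assms(1), of l \<one>] assms h
    by (simp add: lb_def)
  then show ?thesis
    using assms h by simp
qed

lemma move_eq_lb_move:
  assumes "hole S h" "l \<in> I" "l \<noteq> h" "a \<in> carrier M"
  shows "S \<rhd> E h l a = lb h l a S \<rhd> E h l \<one>"
  using assms hole_in_I[OF assms(1)] by (simp add: lb_def)

lemma lb_move_same: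
  assumes "hole S h" "l \<in> I" "l \<noteq> h" "a \<in> carrier M"
  shows "lb h l a S \<rhd> E h l \<one> = lb l h a (S \<rhd> E h l \<one>)"
  using assms hole_in_I[OF assms(1)] move_shift_label[of S h l a \<one>]
  by (simp add: lb_def)

lemma lb_one:
  assumes "hole S h" "k \<in> I" "k \<noteq> h"
  shows "lb h k \<one> S = S"
  using assms by (simp add: lb_def)

lemma lb_lb:
  assumes "hole S h" "k \<in> I" "k \<noteq> h" "a \<in> carrier M" "b \<in> carrier M"
  shows "lb h k b (lb h k a S) = lb h k (a \<otimes> b) S"
proof -
  note h = hole_in_I[OF assms(1)]
  have "lb h k b (lb h k a S) = S \<rhd> E h k \<one> \<rhd> E k h a \<rhd> E h k b \<rhd> E k h \<one>"
    using assms h move_shift_label[of S h k a \<one>] by (simp add: lb_def)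
  also have "\<dots> = S \<rhd> E h k \<one> \<rhd> E k h \<one> \<rhd> E h k (a \<otimes> b) \<rhd> E k h \<one>"
    using assms h move_shift_label[of "S \<rhd> E h k \<one>" k h a b] by simp
  finally show ?thesis
    using assms by (simp add: lb_def)
qed

lemma move_move_eq_lb:
  assumes "hole S h" "k \<in> I" "l \<in> I" "distinct [h, k, l]" "a \<in> carrier M"
  shows "S \<rhd> E h k \<one> \<rhd> E k l a = lb h l a S \<rhd> E h k \<one> \<rhd> E k l \<one>"
proof -
  note h = hole_in_I[OF assms(1)]
  have "S \<rhd> E h k \<one> \<rhd> E k l a = lb k l a (S \<rhd> E h k \<one>) \<rhd> E k l \<one>"
    using assms h by (intro move_eq_lb_move) auto
  then show ?thesis
    using lb_move[of S h l k a] assms by simp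
qed

text \<open>\<open>rel_exchange\<close> is the source, but both its sides leave the hole at
  \<open>k\<close>. So the two orders are compared after the hole has travelled \<open>h\<close>,
  \<open>l\<close>, \<open>k\<close>, which can be undone.\<close>

lemma lb_commute:
  assumes "hole S h" "k \<in> I" "l \<in> I" "distinct [h, k, l]" "a \<in> carrier M" "b \<in> carrier M"
  shows "lb h k a (lb h l b S) = lb h l b (lb h k a S)"
proof -
  note h = hole_in_I[OF assms(1)]
  let ?m = "\<lambda>T. T \<rhd> E h l \<one> \<rhd> E l k \<one>"
  have undo: "?m T \<rhd> E k l \<one> \<rhd> E l h \<one> = T" if "hole T h" for T
    using assms h that by simp
  have "?m (lb h k a (lb h l b S)) = lb h l b S \<rhd> E h l \<one> \<rhd> E l k a"
    using assms h by (intro move_move_eq_lb[symmetric]) auto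
  also have "\<dots> = S \<rhd> E h l b \<rhd> E l k a"
    using assms move_eq_lb_move[of S h l b] by simp
  also have "\<dots> = S \<rhd> E h l \<one> \<rhd> E l k a \<rhd> E k h b \<rhd> E h k \<one>"
    using rel_exchange[of l h k b a S] hole_absorb[OF assms(1), of l \<one>] assms h by simp
  also have "\<dots> = lb k h b (?m (lb h k a S))"
    using assms h move_move_eq_lb[of S h l k a] by (simp add: lb_def)
  also have "\<dots> = lb l h b (lb h k a S \<rhd> E h l \<one>) \<rhd> E l k \<one>"
    using assms h by (intro lb_move[symmetric]) auto
  also have "\<dots> = ?m (lb h l b (lb h k a S))"
    using assms h lb_move_same[of "lb h k a S" h l b] by simp
  finally show ?thesis
    using assms h undo by (metis hole_lb distinct_length_2_or_more)
qed

section \<open>Transpositions of tokens\<close>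

text \<open>In \<open>rel_cycle3\<close> with the hole as third index, the leading letter of the
  longer side is absorbed, and what remains is the same tour run backwards.\<close>

lemma sw_sym:
  assumes "hole S h" "p \<in> I" "q \<in> I" "p \<noteq> h" "q \<noteq> h"
  shows "sw h p q S = sw h q p S"
  using rel_cycle3[of p q h S] hole_absorb[OF assms(1), of p \<one>] hole_in_I[OF assms(1)] assms
  by (auto simp: sw_def)

text \<open>Once the second swap is reversed by symmetry, its tour retraces the first one and the
  moves cancel in pairs.\<close>

lemma sw_sw:
  assumes "hole S h" "p \<in> I" "q \<in> I" "p \<noteq> h" "q \<noteq> h"
  shows "sw h p q (sw h p q S) = S"
proof -
  have "sw h p q (sw h p q S) = sw h q p (sw h p q S)"
    using assms by (intro sw_sym) auto
  then show ?thesis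
    using assms hole_in_I[OF assms(1)] by (auto simp: sw_def)
qed

text \<open>The counterpart of \<open>lb_move\<close> for swaps: \<open>rel_cycle4\<close> with its
  leading letter absorbed.\<close>

lemma sw_move:
  assumes "hole S h" "p \<in> I" "q \<in> I" "l \<in> I" "p \<noteq> h" "q \<noteq> h" "l \<notin> {h, p, q}"
  shows "sw h p q S \<rhd> E h l \<one> = sw l p q (S \<rhd> E h l \<one>)"
  using rel_cycle4[of p q h l S] hole_absorb[OF assms(1), of p \<one>] hole_in_I[OF assms(1)] assms
  by (auto simp: sw_def)

text \<open>Both sides shorten to the hole tour \<open>h\<close>, \<open>l\<close>,
  \<open>p\<close>, \<open>q\<close>, \<open>h\<close>, which is a 3-cycle of tokens.\<close>

lemma sw_braid:
  assumes "hole S h" "p \<in> I" "q \<in> I" "l \<in> I" "distinct [h, p, q, l]"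
  shows "sw h q l (sw h p q S) = sw h p q (sw h p l S)"
proof -
  note h = hole_in_I[OF assms(1)]
  have "sw h q l (sw h p q S) = sw h p q S \<rhd> E h l \<one> \<rhd> E l q \<one> \<rhd> E q h \<one>"
    using assms h sw_sym[of "sw h p q S" h q l] by (auto simp: sw_def)
  also have "\<dots> = S \<rhd> E h l \<one> \<rhd> E l p \<one> \<rhd> E p q \<one> \<rhd> E q h \<one>"
    using assms h sw_move[of S h p q l] by (auto simp: sw_def)
  also have "\<dots> = sw h p q (sw h l p S)"
    using assms h by (simp add: sw_def)
  also have "\<dots> = sw h p q (sw h p l S)"
    using assms sw_sym[of S h p l] by simp
  finally show ?thesis .
qed

text \<open>By \<open>sw_move\<close> the inner swap can be carried past each single move of the
  outer one.\<close>

lemma sw_commute: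
  assumes "hole S h" "p \<in> I" "q \<in> I" "k \<in> I" "l \<in> I" "distinct [h, p, q, k, l]"
  shows "sw h k l (sw h p q S) = sw h p q (sw h k l S)"
proof -
  note h = hole_in_I[OF assms(1)]
  have "sw h k l (sw h p q S) = sw h p q S \<rhd> E h k \<one> \<rhd> E k l \<one> \<rhd> E l h \<one>"
    using assms by (simp add: sw_def)
  also have "\<dots> = sw k p q (S \<rhd> E h k \<one>) \<rhd> E k l \<one> \<rhd> E l h \<one>"
    using assms sw_move[of S h p q k] by auto
  also have "\<dots> = sw l p q (S \<rhd> E h k \<one> \<rhd> E k l \<one>) \<rhd> E l h \<one>"
    using assms h sw_move[of "S \<rhd> E h k \<one>" k p q l] by auto
  also have "\<dots> = sw h p q (S \<rhd> E h k \<one> \<rhd> E k l \<one> \<rhd> E l h \<one>)"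
    using assms h sw_move[of "S \<rhd> E h k \<one> \<rhd> E k l \<one>" l p q h] by auto
  finally show ?thesis
    using assms by (simp add: sw_def)
qed

lemma sw_lb_other:
  assumes "hole S h" "p \<in> I" "q \<in> I" "k \<in> I" "distinct [h, p, q, k]" "a \<in> carrier M"
  shows "sw h p q (lb h k a S) = lb h k a (sw h p q S)"
proof -
  note h = hole_in_I[OF assms(1)]
  have "sw h p q (lb h k a S) = lb h k a S \<rhd> E h p \<one> \<rhd> E p q \<one> \<rhd> E q h \<one>"
    using assms by (simp add: sw_def)
  also have "\<dots> = lb p k a (S \<rhd> E h p \<one>) \<rhd> E p q \<one> \<rhd> E q h \<one>"
    using assms lb_move[of S h k p a] by simp
  also have "\<dots> = lb q k a (S \<rhd> E h p \<one> \<rhd> E p q \<one>) \<rhd> E q h \<one>"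
    using assms h lb_move[of "S \<rhd> E h p \<one>" p k q a] by simp
  also have "\<dots> = lb h k a (S \<rhd> E h p \<one> \<rhd> E p q \<one> \<rhd> E q h \<one>)"
    using assms h lb_move[of "S \<rhd> E h p \<one> \<rhd> E p q \<one>" q k h a] by simp
  finally show ?thesis
    using assms by (simp add: sw_def)
qed

lemma sw_lb_fst:
  assumes "hole S h" "p \<in> I" "q \<in> I" "distinct [h, p, q]" "a \<in> carrier M"
  shows "sw h p q (lb h p a S) = lb h q a (sw h p q S)"
proof -
  note h = hole_in_I[OF assms(1)]
  have "sw h p q (lb h p a S) = lb h p a S \<rhd> E h p \<one> \<rhd> E p q \<one> \<rhd> E q h \<one>"
    using assms by (simp add: sw_def)
  also have "\<dots> = lb p h a (S \<rhd> E h p \<one>) \<rhd> E p q \<one> \<rhd> E q h \<one>"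
    using assms lb_move_same[of S h p a] by simp
  also have "\<dots> = lb q h a (S \<rhd> E h p \<one> \<rhd> E p q \<one>) \<rhd> E q h \<one>"
    using assms h lb_move[of "S \<rhd> E h p \<one>" p h q a] by simp
  also have "\<dots> = lb h q a (S \<rhd> E h p \<one> \<rhd> E p q \<one> \<rhd> E q h \<one>)"
    using assms h lb_move_same[of "S \<rhd> E h p \<one> \<rhd> E p q \<one>" q h a] by simp
  finally show ?thesis
    using assms by (simp add: sw_def)
qed

text \<open>The transposition of \<open>p\<close> and \<open>q\<close>; for \<open>p = q\<close> it
  is the identity, as is \<open>sw\<close>.\<close>

definition tr :: "nat \<Rightarrow> nat \<Rightarrow> nat \<Rightarrow> nat" where
  "tr p q x = (if x = p then q else if x = q then p else x)"

lemma sw_lb: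
  assumes "hole S h" "p \<in> I" "q \<in> I" "k \<in> I" "p \<noteq> h" "q \<noteq> h" "k \<noteq> h" "a \<in> carrier M"
  shows "sw h p q (lb h k a S) = lb h (tr p q k) a (sw h p q S)"
proof (cases "p = q")
  case False
  have "sw h p q (lb h q a S) = lb h p a (sw h p q S)"
    using assms hole_in_I[OF assms(1)] sw_lb_fst[of S h q p a] False
      sw_sym[of S h p q] sw_sym[of "lb h q a S" h p q] by simp
  then show ?thesis
    using assms False sw_lb_fst[of S h p q a] sw_lb_other[of S h p q k a] by (auto simp: tr_def)
qed (auto simp: tr_def)

text \<open>Conjugation of transpositions: in \<open>shuffle_peel\<close>, a swap avoiding
  \<open>m\<close> passes the coset representative \<open>(m x)\<close> and changes only
  \<open>x\<close>.\<close>

lemma sw_conj: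
  assumes "hole S h" "p \<in> I" "q \<in> I" "m \<in> I" "x \<in> I"
    "p \<noteq> h" "q \<noteq> h" "m \<noteq> h" "x \<noteq> h" "p \<noteq> m" "q \<noteq> m"
  shows "sw h p q (sw h m x S) = sw h m (tr p q x) (sw h p q S)"
proof -
  consider "p = q \<or> x = m" | "p \<noteq> q" "x = p" "x \<noteq> m" | "p \<noteq> q" "x = q" "x \<noteq> m"
    | "p \<noteq> q" "x \<noteq> p" "x \<noteq> q" "x \<noteq> m" by blast
  then show ?thesis
  proof cases
    case 1
    then show ?thesis using assms by (auto simp: tr_def)
  next
    case 2
    then show ?thesis
      using assms sw_braid[of S h p q m] sw_sym[of S h m p] sw_sym[of "sw h p q S" h m q]
      by (simp add: tr_def)
  next
    case 3
    then show ?thesis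
      using assms sw_braid[of S h q p m] sw_sym[of S h m q] sw_sym[of "sw h p q S" h m p]
        sw_sym[of S h p q] sw_sym[of "sw h m q S" h p q]
      by (simp add: tr_def)
  next
    case 4
    then show ?thesis
      using assms sw_commute[of S h m x p q] by (simp add: tr_def)
  qed
qed

text \<open>The companion of \<open>sw_conj\<close> for two swaps of \<open>m\<close>: the swap
  split off on the right, \<open>(x q)\<close>, avoids \<open>m\<close>.\<close>

lemma sw_conj_same:
  assumes "hole S h" "q \<in> I" "m \<in> I" "x \<in> I" "distinct [h, m, x, q]"
  shows "sw h m q (sw h m x S) = sw h m x (sw h x q S)"
  using assms sw_braid[of S h x m q] sw_sym[of S h m x] sw_sym[of "sw h x q S" h m x] by simp

subsection \<open>Hole paths\<close>

inductive path :: "nat \<Rightarrow> 'm letter list \<Rightarrow> nat \<Rightarrow> bool" for h where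
  path_Nil: "path h [] h"
| path_snoc: "\<lbrakk>path h w x; k \<in> I; k \<noteq> x; a \<in> carrier M\<rbrakk> \<Longrightarrow> path h (w @ [E x k a]) k"

lemma path_lists: "path h w x \<Longrightarrow> h \<in> I \<Longrightarrow> w \<in> lists X \<and> x \<in> I"
  by (induction rule: path.induct) auto

lemma path_hole: "path h w x \<Longrightarrow> hole S h \<Longrightarrow> hole (run S w) x"
  by (induction rule: path.induct) (auto simp: path_lists hole_in_I)

lemma path_append: "path x v y \<Longrightarrow> path h u x \<Longrightarrow> path h (u @ v) y"
proof (induction rule: path.induct)
  case (path_snoc w y k a)
  then show ?case
    using path.path_snoc[of h "u @ w" y k a] by simp
qed simp

lemma path_reverse:
  assumes "path h w x" "h \<in> I"
  shows "\<exists>w'. path x w' h \<and> (\<forall>S. hole S h \<longrightarrow> run S (w @ w') = S) \<and>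
    (\<forall>S. hole S x \<longrightarrow> run S (w' @ w) = S)"
  using assms
proof (induction rule: path.induct)
  case path_Nil
  show ?case
    by (intro exI[of _ "[]"]) (auto intro: path.path_Nil)
next
  case (path_snoc w x k a)
  from path_snoc.IH[OF path_snoc.prems]
  obtain w' where w': "path x w' h" "\<And>S. hole S h \<Longrightarrow> run S (w @ w') = S"
    "\<And>S. hole S x \<Longrightarrow> run S (w' @ w) = S" by auto
  have x: "x \<in> I" using path_lists[OF path_snoc.hyps(1) \<open>h \<in> I\<close>] by simp
  have "path k ([] @ [E k x (inv a)]) x"
    using path_snoc x by (intro path.intros) auto
  then have p: "path k (E k x (inv a) # w') h"
    using path_append[OF w'(1), of k "[E k x (inv a)]"] by simp
  have 1: "run S ((w @ [E x k a]) @ E k x (inv a) # w') = S" if "hole S h" for S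
    using move_back[of "run S w" x k a] path_hole[OF path_snoc.hyps(1) that] path_snoc w'(2)[OF that]
    by simp
  have 2: "run S ((E k x (inv a) # w') @ w @ [E x k a]) = S" if "hole S k" for S
    using move_back[OF that, of x "inv a"] w'(3)[of "S \<rhd> E k x (inv a)"] path_snoc x by simp
  show ?case
    by (rule exI[of _ "E k x (inv a) # w'"], intro conjI allI impI, rule p) (erule 1 2)+
qed

lemma path_pos_neq: "path h w x \<Longrightarrow> k \<noteq> h \<Longrightarrow> pos w k \<noteq> x"
  by (induction rule: path.induct) auto

text \<open>Tokens move only into the tracked hole, so away from \<open>h\<close> a path never
  merges.\<close>

lemma path_inj: "path h w x \<Longrightarrow> k \<noteq> h \<Longrightarrow> l \<noteq> h \<Longrightarrow> pos w k = pos w l \<Longrightarrow> k = l"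
  by (induction rule: path.induct) (auto dest: path_pos_neq split: if_splits)

lemma path_holes:
  assumes "path h w x" "hole S h" "y \<in> I" "y \<notin> pos w ` {r \<in> I. \<not> hole S r}"
  shows "hole (run S w) y"
  using assms
proof (induction arbitrary: y rule: path.induct)
  case (path_snoc w x k a)
  have x: "hole (run S w) x" "x \<in> I"
    using path_hole[OF path_snoc.hyps(1) \<open>hole S h\<close>] hole_in_I by auto
  show ?case
  proof (cases "y = k")
    case False
    show ?thesis
    proof (cases "y = x")
      \<comment> \<open>The letter would fill \<open>x\<close> from \<open>k\<close>. As
        \<open>x\<close> receives no token, \<open>k\<close> was already a hole and the letter
        changes nothing.\<close>
      case True
      have "k \<notin> pos w ` {r \<in> I. \<not> hole S r}"
        using path_snoc.prems True by (auto simp: image_iff)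
      then have "hole (run S w) k"
        using path_snoc.IH path_snoc.prems path_snoc.hyps(2) by simp
      then show ?thesis
        using path_snoc x True hole_absorb[of "run S w" k x a] by simp
    next
      case False
      have "y \<notin> pos w ` {r \<in> I. \<not> hole S r}"
        using path_snoc.prems \<open>y \<noteq> k\<close> False by (auto simp: image_iff)
      then show ?thesis
        using path_snoc x False \<open>y \<noteq> k\<close> hole_keep[of "run S w" y x k a] by simp
    qed
  qed (use path_snoc x in simp)
qed auto

text \<open>A letter after the path is traced back move by move: if one of its ends is the place a
  token has just reached, that end is replaced by the place the token came from.\<close>

lemma path_push:
  assumes "path h w x" "h \<in> I" "p \<in> I" "q \<in> I" "p \<noteq> q" "p \<noteq> x" "q \<noteq> x" "b \<in> carrier M"
  shows "\<exists>p' q' b'. p' \<in> I - {h} \<and> q' \<in> I - {h} \<and> p' \<noteq> q' \<and> b' \<in> carrier M \<and>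
    (\<forall>S. hole S h \<longrightarrow> run S w \<rhd> E p q b = run (S \<rhd> E p' q' b') w)"
  using assms
proof (induction arbitrary: p q b rule: path.induct)
  case path_Nil
  then show ?case by auto
next
  case (path_snoc w x k a)
  have x: "x \<in> I" using path_lists[OF path_snoc.hyps(1) \<open>h \<in> I\<close>] by simp
  have "\<exists>p' q' b'. p' \<in> I - {x} \<and> q' \<in> I - {x} \<and> p' \<noteq> q' \<and> b' \<in> carrier M \<and>
    (\<forall>S. hole S x \<longrightarrow> S \<rhd> E x k a \<rhd> E p q b = S \<rhd> E p' q' b' \<rhd> E x k a)"
  proof -
    consider "p \<noteq> x" "q \<noteq> x" | "p = x" "q \<noteq> x" | "q = x" "p \<noteq> x" using path_snoc by blast
    then show ?thesis
    proof cases
      case 1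
      have "S \<rhd> E x k a \<rhd> E p q b = S \<rhd> E p q b \<rhd> E x k a" for S
        using path_snoc x 1 by (intro rel_commute) auto
      then show ?thesis
        using path_snoc 1 by - (rule exI[of _ p], rule exI[of _ q], rule exI[of _ b], simp)
    next
      case 2
      \<comment> \<open>The content of \<open>k\<close> is about to move to \<open>x\<close> with
        label \<open>a\<close>, so the earlier letter must compensate for \<open>a\<close>.\<close>
      have "S \<rhd> E k q (b \<otimes> inv a) \<rhd> E x k a = S \<rhd> E x k a \<rhd> E x q b" for S
        using path_snoc x 2 rel_chain[of x k q "b \<otimes> inv a" a S] by (simp add: m_assoc)
      moreover have "b \<otimes> inv a \<in> carrier M" "k \<in> I - {x}" "q \<in> I - {x}" "k \<noteq> q"
        using path_snoc 2 by auto
      ultimately show ?thesis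
        using 2 by - (rule exI[of _ k], rule exI[of _ q], rule exI[of _ "b \<otimes> inv a"], simp)
    next
      case 3
      \<comment> \<open>Brought to the front, \<open>E p x b\<close> is absorbed at the hole
        \<open>x\<close>; behind a letter into \<open>k\<close>, the move \<open>E x k a\<close> can
        be reinserted freely.\<close>
      have "S \<rhd> E x k a \<rhd> E p x b = S \<rhd> E p k (a \<otimes> b) \<rhd> E x k a" if "hole S x" for S
        using path_snoc x 3 rel_chain[of p x k a b S] hole_absorb[OF that, of p b]
          rel_absorb[of p x k "a \<otimes> b" a S] by auto
      moreover have "a \<otimes> b \<in> carrier M" "p \<in> I - {x}" "k \<in> I - {x}" "p \<noteq> k"
        using path_snoc 3 by auto
      ultimately show ?thesis
        using 3 by - (rule exI[of _ p], rule exI[of _ k], rule exI[of _ "a \<otimes> b"], simp)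
    qed
  qed
  then obtain p' q' b' where *: "p' \<in> I" "q' \<in> I" "p' \<noteq> x" "q' \<noteq> x" "p' \<noteq> q'" "b' \<in> carrier M"
    "\<And>S. hole S x \<Longrightarrow> S \<rhd> E x k a \<rhd> E p q b = S \<rhd> E p' q' b' \<rhd> E x k a" by blast
  from path_snoc.IH[OF path_snoc.prems(1) this(1,2,5,3,4,6)]
  obtain p'' q'' b'' where **: "p'' \<in> I - {h}" "q'' \<in> I - {h}" "p'' \<noteq> q''" "b'' \<in> carrier M"
    "\<And>S. hole S h \<Longrightarrow> run S w \<rhd> E p' q' b' = run (S \<rhd> E p'' q'' b'') w" by blast
  have "run S (w @ [E x k a]) \<rhd> E p q b = run (S \<rhd> E p'' q'' b'') (w @ [E x k a])" if "hole S h" for S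
    using *(7)[OF path_hole[OF path_snoc.hyps(1) that]] **(5)[OF that] by simp
  then show ?case
    using **(1-4) by - (rule exI[of _ p''], rule exI[of _ q''], rule exI[of _ b''], simp)
qed

subsection \<open>Closed hole paths\<close>

text \<open>Tours of the hole that start and end at \<open>h\<close>. The parameter \<open>A\<close>
  bounds the positions they visit besides \<open>h\<close> and shrinks when tokens are peeled
  off.\<close>

inductive shuffle :: "nat \<Rightarrow> nat set \<Rightarrow> 'm letter list \<Rightarrow> bool" for h A where
  shuffle_Nil: "shuffle h A []"
| shuffle_swap: "\<lbrakk>shuffle h A w; p \<in> A; q \<in> A; p \<noteq> q\<rbrakk> \<Longrightarrow>
    shuffle h A (w @ [E h p \<one>, E p q \<one>, E q h \<one>])"
| shuffle_label: "\<lbrakk>shuffle h A w; k \<in> A; a \<in> carrier M\<rbrakk> \<Longrightarrow> shuffle h A (w @ [E h k a, E k h \<one>])"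

lemma run_swap: "p \<noteq> q \<Longrightarrow> run S [E h p \<one>, E p q \<one>, E q h \<one>] = sw h p q S"
  by (simp add: sw_def)

lemma shuffle_lists: "shuffle h A w \<Longrightarrow> h \<in> I \<Longrightarrow> A \<subseteq> I - {h} \<Longrightarrow> w \<in> lists X"
  by (induction rule: shuffle.induct) auto

lemma shuffle_hole: "shuffle h A w \<Longrightarrow> A \<subseteq> I - {h} \<Longrightarrow> hole S h \<Longrightarrow> hole (run S w) h"
  by (induction rule: shuffle.induct) (auto simp: hole_in_I subset_iff)

lemma shuffle_fix:
  "shuffle h A w \<Longrightarrow> h \<in> I \<Longrightarrow> A \<subseteq> I - {h} \<Longrightarrow> m \<notin> A \<Longrightarrow> m \<noteq> h \<Longrightarrow> pos w m = m \<and> lab w m = \<one>"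
proof (induction rule: shuffle.induct)
  case (shuffle_swap w p q)
  then have "w \<in> lists X" "[E h p \<one>, E p q \<one>, E q h \<one>] \<in> lists X"
    using shuffle_lists by auto
  then show ?case
    using shuffle_swap by (auto simp del: append_in_lists_conv)
next
  case (shuffle_label w k a)
  then have "w \<in> lists X" "[E h k a, E k h \<one>] \<in> lists X"
    using shuffle_lists by auto
  then show ?case
    using shuffle_label by auto
qed simp

text \<open>A move away from \<open>h\<close> is closed to a tour by inserting a return to
  \<open>h\<close> and undoing it, so at most one bare move is left over.\<close>

lemma path_shuffle:
  assumes "path h w x" "h \<in> I"
  shows "\<exists>w'. shuffle h (I - {h}) w' \<and> (\<forall>S. hole S h \<longrightarrow>
    run S w = (if x = h then run S w' else run S w' \<rhd> E h x \<one>))"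
  using assms
proof (induction rule: path.induct)
  case path_Nil
  show ?case
    by (intro exI[of _ "[]"]) (auto intro: shuffle.intros)
next
  case (path_snoc w x y a)
  then obtain w' where w': "shuffle h (I - {h}) w'" "\<And>S. hole S h \<Longrightarrow>
    run S w = (if x = h then run S w' else run S w' \<rhd> E h x \<one>)" by blast
  have x: "x \<in> I" using path_lists[OF path_snoc.hyps(1) \<open>h \<in> I\<close>] by simp
  have hw': "hole (run S w') h" if "hole S h" for S
    using shuffle_hole[OF w'(1) _ that] by simp
  consider "x = h" | "x \<noteq> h" "y = h" | "x \<noteq> h" "y \<noteq> h" by blast
  then show ?case
  proof cases
    case 1
    let ?w = "w' @ [E h y a, E y h \<one>]"
    have "shuffle h (I - {h}) ?w"
      using path_snoc w' 1 by (intro shuffle.intros) auto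
    moreover have "run S (w @ [E x y a]) = run S ?w \<rhd> E h y \<one>" if "hole S h" for S
      using move_eq_lb_move[OF hw'[OF that], of y a] w'(2)[OF that] path_snoc 1
      by (simp add: lb_def)
    ultimately show ?thesis
      using path_snoc 1 by (intro exI[of _ ?w]) auto
  next
    case 2
    let ?w = "w' @ [E h x a, E x h \<one>]"
    have "shuffle h (I - {h}) ?w"
      using path_snoc w' 2 x by (intro shuffle.intros) auto
    moreover have "run S (w @ [E x y a]) = run S ?w" if "hole S h" for S
      using move_shift_label[OF hw'[OF that], of x a \<one>] w'(2)[OF that] path_snoc 2 x by simp
    ultimately show ?thesis
      using path_snoc 2 by (intro exI[of _ ?w]) auto
  next
    case 3
    \<comment> \<open>\<open>move_move_eq_lb\<close> pulls the label to the front; the bare moves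
      \<open>h\<close>, \<open>x\<close>, \<open>y\<close> become a swap once the return to
      \<open>h\<close> is inserted.\<close>
    let ?w = "(w' @ [E h y a, E y h \<one>]) @ [E h x \<one>, E x y \<one>, E y h \<one>]"
    have "shuffle h (I - {h}) ?w"
      using path_snoc w' 3 x by (intro shuffle.intros) auto
    moreover have "run S (w @ [E x y a]) = run S ?w \<rhd> E h y \<one>" if "hole S h" for S
      using move_move_eq_lb[OF hw'[OF that], of x y a] w'(2)[OF that] path_snoc 3 x
      by (auto simp: lb_def)
    ultimately show ?thesis
      using path_snoc 3 by (intro exI[of _ ?w]) auto
  qed
qed

text \<open>
  Imitates the factorization of a permutation as a permutation fixing \<open>m\<close> followed by a
  transposition \<open>(m x)\<close>.
\<close>

lemma shuffle_peel:
  assumes "shuffle h A w" "h \<in> I" "A \<subseteq> I - {h}" "m \<in> A"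
  shows "\<exists>w' x a. shuffle h (A - {m}) w' \<and> x \<in> A \<and> a \<in> carrier M \<and>
    (\<forall>S. hole S h \<longrightarrow> run S w = lb h x a (sw h m x (run S w')))"
  using assms
proof (induction rule: shuffle.induct)
  case shuffle_Nil
  \<comment> \<open>The choice \<open>x = m\<close> stands for the trivial coset.\<close>
  then show ?case
    by (intro exI[of _ "[]"] exI[of _ m] exI[of _ \<one>]) (auto intro: shuffle.intros simp: lb_one subset_iff)
next
  case (shuffle_swap w p q)
  then obtain w' x a where w': "shuffle h (A - {m}) w'" "x \<in> A" "a \<in> carrier M"
    "\<And>S. hole S h \<Longrightarrow> run S w = lb h x a (sw h m x (run S w'))" by blast
  have m: "m \<in> I" "m \<noteq> h" and x: "x \<in> I" "x \<noteq> h"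
    using shuffle_swap w' by auto
  have A: "k \<in> I \<and> k \<noteq> h" if "k \<in> A" for k
    using that shuffle_swap.prems by auto
  have hw': "hole (run S w') h" if "hole S h" for S
    using shuffle_hole[OF w'(1) _ that] shuffle_swap.prems by auto
  have run: "run S (w @ [E h p \<one>, E p q \<one>, E q h \<one>]) =
      lb h (tr p q x) a (sw h p q (sw h m x (run S w')))" if "hole S h" for S
    using w'(4)[OF that] hw'[OF that] sw_lb[of "sw h m x (run S w')" h p q x a]
      run_swap[OF shuffle_swap.hyps(4)] A[of p] A[of q] shuffle_swap m x w'(3)
    by (simp del: run_simps(2))
  have sym: "sw h p q (sw h m x (run S w')) = sw h q p (sw h m x (run S w'))" if "hole S h" for S
    using hw'[OF that] A[of p] A[of q] m x shuffle_swap by (intro sw_sym) auto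
  \<comment> \<open>The new swap exchanges \<open>m\<close> with \<open>r\<close>. If
    \<open>x = m\<close> it is the only swap, if \<open>x = r\<close> the two cancel, and otherwise
    a swap of \<open>x\<close> and \<open>r\<close> splits off and joins \<open>w'\<close>.\<close>
  have same: "\<exists>w'' x' a. shuffle h (A - {m}) w'' \<and> x' \<in> A \<and> a \<in> carrier M \<and>
      (\<forall>S. hole S h \<longrightarrow> lb h (tr m r x) a' (sw h m r (sw h m x (run S w'))) =
        lb h x' a (sw h m x' (run S w'')))"
    if r: "r \<in> A" "r \<noteq> m" and a': "a' \<in> carrier M" for r a'
  proof -
    consider "x = m" | "x \<noteq> m" "x = r" | "x \<noteq> m" "x \<noteq> r" by blast
    then show ?thesis
    proof cases
      case 1
      then show ?thesis
        using r w' a' by (intro exI[of _ w'] exI[of _ r] exI[of _ a']) (auto simp: tr_def)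
    next
      case 2
      have "sw h m r (sw h m x (run S w')) = run S w'" if "hole S h" for S
        using hw'[OF that] A[of r] r m 2 sw_sw by simp
      then show ?thesis
        using r w' a' m 2 shuffle_swap.prems
        by (intro exI[of _ w'] exI[of _ m] exI[of _ a']) (auto simp: tr_def)
    next
      case 3
      let ?w = "w' @ [E h x \<one>, E x r \<one>, E r h \<one>]"
      have "shuffle h (A - {m}) ?w"
        using r w' 3 by (intro shuffle.intros) auto
      moreover have "sw h m r (sw h m x (run S w')) = sw h m x (run S ?w)" if "hole S h" for S
        using hw'[OF that] A[of r] r m x 3 sw_conj_same[of "run S w'" h r m x]
        by (auto simp: sw_def)
      ultimately show ?thesis
        using r w' a' 3 by (intro exI[of _ ?w] exI[of _ x] exI[of _ a']) (auto simp: tr_def)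
    qed
  qed
  consider "m = p" | "m = q" "m \<noteq> p" | "m \<noteq> p" "m \<noteq> q" by blast
  then show ?case
  proof cases
    case 1
    then show ?thesis
      using same[of q a] run w' shuffle_swap by simp
  next
    case 2
    have "tr p q x = tr q p x" by (auto simp: tr_def)
    then show ?thesis
      using same[of p a] run sym w' shuffle_swap 2 by simp
  next
    case 3
    let ?w = "w' @ [E h p \<one>, E p q \<one>, E q h \<one>]"
    have "shuffle h (A - {m}) ?w"
      using shuffle_swap w' 3 by (intro shuffle.intros) auto
    moreover have "tr p q x \<in> A"
      using shuffle_swap w' by (auto simp: tr_def)
    moreover have "sw h p q (sw h m x (run S w')) = sw h m (tr p q x) (run S ?w)" if "hole S h" for S
      using sw_conj[OF hw'[OF that], of p q m x] A[of p] A[of q] m x 3 shuffle_swap by (simp add: sw_def)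
    ultimately show ?thesis
      using run w'(3) by (intro exI[of _ ?w] exI[of _ "tr p q x"] exI[of _ a]) auto
  qed
next
  case (shuffle_label w y b)
  then obtain w' x a where w': "shuffle h (A - {m}) w'" "x \<in> A" "a \<in> carrier M"
    "\<And>S. hole S h \<Longrightarrow> run S w = lb h x a (sw h m x (run S w'))" by blast
  have m: "m \<in> I" "m \<noteq> h" and x: "x \<in> I" "x \<noteq> h" and y: "y \<in> I" "y \<noteq> h"
    using shuffle_label w' by auto
  have hw': "hole (run S w') h" if "hole S h" for S
    using shuffle_hole[OF w'(1) _ that] shuffle_label.prems by auto
  have run: "run S (w @ [E h y b, E y h \<one>]) = lb h y b (lb h x a (sw h m x (run S w')))"
    if "hole S h" for S
    using w'(4)[OF that] by (simp add: lb_def)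
  show ?case
  proof (cases "x = y")
    case True
    have "run S (w @ [E h y b, E y h \<one>]) = lb h x (a \<otimes> b) (sw h m x (run S w'))" if "hole S h" for S
      unfolding run[OF that] True using hw'[OF that] m x y w' shuffle_label
      by (intro lb_lb) auto
    then show ?thesis
      using w' shuffle_label by (intro exI[of _ w'] exI[of _ x] exI[of _ "a \<otimes> b"]) auto
  next
    case False
    \<comment> \<open>The relabelling of \<open>y\<close> is pulled back through the swap;
      \<open>x \<noteq> y\<close> ensures that it does not land on \<open>m\<close>.\<close>
    let ?z = "tr m x y"
    let ?w = "w' @ [E h ?z b, E ?z h \<one>]"
    have z: "?z \<in> A - {m}" "tr m x ?z = y" "?z \<in> I" "?z \<noteq> h"
      using shuffle_label w' False m x y by (auto simp: tr_def)
    have "shuffle h (A - {m}) ?w"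
      using shuffle_label w' z by (intro shuffle.intros) auto
    moreover have "run S (w @ [E h y b, E y h \<one>]) = lb h x a (sw h m x (run S ?w))" if "hole S h" for S
    proof -
      have "lb h y b (lb h x a (sw h m x (run S w'))) = lb h x a (lb h y b (sw h m x (run S w')))"
        using hw'[OF that] m x y w' False shuffle_label by (intro lb_commute) auto
      also have "lb h y b (sw h m x (run S w')) = sw h m x (lb h ?z b (run S w'))"
        using sw_lb[OF hw'[OF that], of m x ?z b] m x z shuffle_label by simp
      finally show ?thesis
        using run[OF that] by (simp add: lb_def)
    qed
    ultimately show ?thesis
      using w' by (intro exI[of _ ?w] exI[of _ x] exI[of _ a]) auto
  qed
qed

text \<open>Every letter of \<open>w\<close> points into a hole of \<open>S\<close>, and absorbing
  it leaves the state unchanged for the next one.\<close>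

lemma shuffle_on_holes:
  assumes "shuffle h Y w" "Y \<subseteq> I - {h}" "hole S h" "\<And>y. y \<in> Y \<Longrightarrow> hole S y"
  shows "run S w = S"
  using assms
proof (induction rule: shuffle.induct)
  case (shuffle_swap w p q)
  then show ?case
    using hole_absorb[of S p h \<one>] hole_absorb[of S q p \<one>] hole_absorb[of S h q \<one>] hole_in_I[of S h]
    by (auto simp: subset_iff)
next
  case (shuffle_label w k a)
  then show ?case
    using hole_absorb[of S k h a] hole_absorb[of S h k \<one>] hole_in_I[of S h] by (auto simp: subset_iff)
qed simp

text \<open>In its application \<open>R\<close> consists of the positions that a star leaves
  occupied and \<open>Y\<close> of the untracked holes. Each peeled factor is forced to be trivial
  by the action; when \<open>R\<close> is exhausted, only holes are moved.\<close>

lemma shuffle_trivial: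
  assumes "finite R" and u: "u \<in> lists X" "u \<noteq> []" and h: "h \<in> I" "\<And>S. hole (run S u) h"
    and Y: "\<And>S y. y \<in> Y \<Longrightarrow> hole (run S u) y" "Y \<subseteq> I - {h}"
    and R: "R \<subseteq> I - {h}" "R \<inter> Y = {}" "\<And>r. r \<in> R \<Longrightarrow> pos u r = r \<and> lab u r = \<one>"
    and w: "shuffle h (R \<union> Y) w" "\<And>r. r \<in> R \<Longrightarrow> pos w r = r \<and> lab w r = \<one>"
  shows "u @ w \<approx> u"
  using \<open>finite R\<close> R w
proof (induction R arbitrary: w rule: finite_induct)
  case empty
  show ?case
  proof (rule run_eqvI)
    fix S
    show "run S (u @ w) = run S u"
      using shuffle_on_holes[of h Y w "run S u"] empty h Y by simp
  qed
next
  case (insert m R)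
  have "insert m R \<union> Y \<subseteq> I - {h}" "(insert m R \<union> Y) - {m} = R \<union> Y" and m: "m \<in> I" "m \<noteq> h"
    using insert Y by auto
  then obtain w' x a where w': "shuffle h (R \<union> Y) w'" "x \<in> insert m R \<union> Y" "a \<in> carrier M"
    "\<And>S. hole S h \<Longrightarrow> run S w = lb h x a (sw h m x (run S w'))"
    using shuffle_peel[OF insert.prems(4) h(1), of m] by auto
  \<comment> \<open>A word for the peeled factor: it sends \<open>m\<close> to \<open>x\<close> with
    label \<open>a\<close>. Since \<open>w'\<close> fixes \<open>m\<close>, comparing actions yields
    \<open>x = m\<close> and \<open>a = \<one>\<close>.\<close>
  define v where "v = (if m = x then [] else [E h m \<one>, E m x \<one>, E x h \<one>]) @ [E h x a, E x h \<one>]"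
  have xI: "x \<in> I" "x \<noteq> h"
    using w' insert.prems Y by auto
  have lists: "w \<in> lists X" "w' \<in> lists X" "v \<in> lists X"
    using shuffle_lists[OF insert.prems(4) h(1)] shuffle_lists[OF w'(1) h(1)] insert.prems(1) Y xI h m w'(3)
    by (auto simp: v_def simp del: in_lists_conv_set)
  have wv: "u @ w \<approx> u @ w' @ v"
    by (rule run_eqvI) (simp add: w'(4)[OF h(2)] v_def lb_def sw_def)
  have "act_eq (u @ w) (u @ w' @ v)"
    using run_eqv_act_eq[OF wv] u lists by simp
  then have "pos (w' @ v) m = m \<and> lab (w' @ v) m = \<one>"
    using insert.prems(3,5)[of m] u lists m by (auto simp: act_eq_def)
  moreover have "pos w' m = m \<and> lab w' m = \<one>"
  proof (rule shuffle_fix[OF w'(1) h(1)])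
    show "R \<union> Y \<subseteq> I - {h}" "m \<notin> R \<union> Y" "m \<noteq> h"
      using insert.hyps insert.prems(1,2) Y m by auto
  qed
  ultimately have "pos v m = m" "lab v m = \<one>"
    using lists by auto
  then have "x = m" "a = \<one>"
    using xI m w'(3) by (auto simp: v_def split: if_splits)
  have "hole (run (run S u) w') h" for S
    using insert.prems(1) Y by (intro shuffle_hole[OF w'(1) _ h(2)]) auto
  then have ww': "u @ w \<approx> u @ w'"
    using w'(4)[OF h(2)] m \<open>x = m\<close> \<open>a = \<one>\<close> by (intro run_eqvI) (simp add: lb_one)
  then have "act_eq (u @ w) (u @ w')"
    using run_eqv_act_eq[OF ww'] u lists by simp
  then have "pos w' r = r \<and> lab w' r = \<one>" if "r \<in> R" for r
  proof -
    have "r \<in> I" "pos u r = r \<and> lab u r = \<one>" "pos w r = r \<and> lab w r = \<one>"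
      using that insert.prems(1) insert.prems(3,5)[of r] by auto
    then show ?thesis
      using act_eqD[OF \<open>act_eq (u @ w) (u @ w')\<close>, of r] u lists by (simp del: in_lists_conv_set)
  qed
  then have "u @ w' \<approx> u"
    using insert.IH[OF _ _ _ w'(1)] insert.prems(1-3) by auto
  with ww' show ?case
    by (simp add: run_eqv_def)
qed

subsection \<open>Stars\<close>

text \<open>Stars act as labelled retractions onto the complement of their targets. Disjointness of
  sources and targets makes the order of the letters irrelevant modulo the relations.\<close>

definition star :: "'m letter list \<Rightarrow> bool" where
  "star s \<longleftrightarrow> s \<in> lists X \<and> distinct (map tgt s) \<and> src ` set s \<inter> tgt ` set s = {}"

lemma star_Cons: "star (x # s) \<Longrightarrow> star s"
  by (auto simp: star_def)

lemma star_snoc: "star (s @ [x]) \<Longrightarrow> star s"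
  by (auto simp: star_def)

lemma star_lists: "star s \<Longrightarrow> s \<in> lists X"
  by (simp add: star_def)

lemma star_tgt: "star s \<Longrightarrow> tgt ` set s \<subseteq> I"
  by (auto simp: star_def X1_def I_def)

lemma star_letter: "star s \<Longrightarrow> E i j a \<in> set s \<Longrightarrow>
    i \<in> I \<and> j \<in> I \<and> i \<noteq> j \<and> a \<in> carrier M \<and> j \<in> tgt ` set s \<and> i \<notin> tgt ` set s"
  unfolding star_def by (metis E_in_X disjoint_iff image_eqI in_lists_conv_set src.simps tgt.simps)

lemma star_commute:
  assumes "star s" "x \<in> set s" "y \<in> set s"
  shows "S \<rhd> x \<rhd> y = S \<rhd> y \<rhd> x"
proof (cases "x = y")
  case False
  obtain i j a where x: "x = E i j a" by (cases x)
  obtain k l b where y: "y = E k l b" by (cases y)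
  have "tgt x \<noteq> tgt y"
    using assms False by (auto simp: star_def distinct_map dest: inj_onD)
  then have "j \<noteq> l" "i \<noteq> l" "k \<noteq> j" and i: "i \<in> I" "j \<in> I" "i \<noteq> j" "a \<in> carrier M"
    and k: "k \<in> I" "l \<in> I" "k \<noteq> l" "b \<in> carrier M"
    using star_letter[OF assms(1), of i j a] star_letter[OF assms(1), of k l b] assms(2,3) x y by auto
  then show ?thesis
    using rel_fork[of i j l a b S] rel_commute[of i j k l a b S] x y by (cases "i = k") auto
qed simp

text \<open>The extra letter commutes through the star to its own occurrence, where it is
  idempotent.\<close>

lemma star_absorb_letter: "star s \<Longrightarrow> x \<in> set s \<Longrightarrow> run (S \<rhd> x) s = run S s"
proof (induction s arbitrary: S)
  case (Cons y s)
  show ?case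
  proof (cases "x = y")
    case True
    obtain i j a where "y = E i j a" by (cases y)
    then show ?thesis
      using star_letter[OF Cons.prems(1), of i j a] True by (simp add: rel_idem)
  next
    case False
    have "run (S \<rhd> x) (y # s) = run (S \<rhd> y \<rhd> x) s"
      using star_commute[OF Cons.prems(1), of x y S] Cons.prems(2) by simp
    then show ?thesis
      using Cons.IH[OF star_Cons[OF Cons.prems(1)]] Cons.prems(2) False by simp
  qed
qed simp

lemma star_hole: "star s \<Longrightarrow> j \<in> tgt ` set s \<Longrightarrow> hole (run S s) j"
proof (induction s rule: rev_induct)
  case (snoc y s)
  obtain p q b where y: "y = E p q b" by (cases y)
  have yI: "p \<in> I" "q \<in> I" "p \<noteq> q" "b \<in> carrier M" "p \<noteq> j"
    using star_letter[OF snoc.prems(1), of p q b] snoc.prems(2) y by auto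
  show ?case
  proof (cases "q = j")
    case False
    then show ?thesis
      using snoc star_snoc[OF snoc.prems(1)] y yI by (auto intro: hole_keep)
  qed (use y yI in simp)
qed simp

lemma star_fix: "k \<notin> tgt ` set s \<Longrightarrow> pos s k = k \<and> lab s k = \<one>"
  by (induction s k rule: pos.induct) auto

lemma star_act: "star s \<Longrightarrow> E i j a \<in> set s \<Longrightarrow> pos s j = i \<and> lab s j = a"
proof (induction s)
  case (Cons y s)
  obtain p q b where y: "y = E p q b" by (cases y)
  show ?case
  proof (cases "q = j")
    case True
    have "inj_on tgt (set (y # s))"
      using Cons.prems by (simp only: star_def distinct_map)
    then have "y = E i j a"
      using inj_onD[of tgt "set (y # s)" y "E i j a"] Cons.prems(2) y True by simp
    moreover have "i \<notin> tgt ` set s"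
      using star_letter[OF Cons.prems] by auto
    ultimately show ?thesis
      using star_fix[of i s] star_letter[OF Cons.prems] by auto
  next
    case False
    then show ?thesis
      using Cons star_Cons[OF Cons.prems(1)] y by auto
  qed
qed simp

lemma star_pos:
  assumes "star s" "k \<in> I"
  shows "pos s k \<in> I - tgt ` set s"
proof (cases "k \<in> tgt ` set s")
  case True
  then obtain i a where "E i k a \<in> set s"
    by (metis imageE tgt.elims)
  then show ?thesis
    using star_act[OF assms(1)] star_letter[OF assms(1)] by auto
qed (use star_fix assms in auto)

text \<open>\<open>q\<close> ceases to be a representative, so every letter collapsing a position
  onto \<open>q\<close> is redirected to \<open>p\<close>, its label multiplied by \<open>b\<close>;
  \<open>rel_chain\<close> does exactly this.\<close>

lemma star_merge:
  assumes "star s" "p \<in> I - tgt ` set s" "q \<in> I - tgt ` set s" "p \<noteq> q" "b \<in> carrier M"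
  shows "\<exists>s'. star s' \<and> tgt ` set s \<subseteq> tgt ` set s' \<and> s @ [E p q b] \<approx> s'"
proof -
  define f where
    "f = (\<lambda>x. case x of E i j a \<Rightarrow> if i = q then E p j (a \<otimes> b) else E i j a)"
  have pq: "p \<in> I" "q \<in> I"
    using assms by auto
  have f: "tgt (f x) = tgt x" "src (f x) = (if src x = q then p else src x)" for x
    by (auto simp: f_def split: letter.split)
  have f_in: "f x \<in> X" if "x \<in> X" "tgt x \<noteq> p" for x
    using that assms by (cases x) (auto simp: f_def)
  have run: "run S t \<rhd> E p q b = run (S \<rhd> E p q b) (map f t)"
    if "t \<in> lists X" "tgt ` set t \<subseteq> tgt ` set s" for t S
    using that
  proof (induction t arbitrary: S rule: list.induct)
    case (Cons x t)
    obtain i j a where x: "x = E i j a" by (cases x)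
    have ij: "i \<in> I" "j \<in> I" "i \<noteq> j" "a \<in> carrier M" "j \<noteq> p" "j \<noteq> q"
      using Cons.prems x assms by auto
    consider "i = q" | "i \<noteq> q" "i = p" | "i \<noteq> q" "i \<noteq> p" by blast
    then have "S \<rhd> x \<rhd> E p q b = S \<rhd> E p q b \<rhd> f x"
    proof cases
      case 1
      then show ?thesis
        using ij pq assms(4,5) rel_chain[of p q j a b S] x by (simp add: f_def)
    next
      case 2
      then show ?thesis
        using ij pq assms(4,5) rel_fork[of p j q a b S] x by (simp add: f_def)
    next
      case 3
      then show ?thesis
        using ij pq assms(4,5) rel_commute[of i j p q a b S] x by (simp add: f_def)
    qed
    then show ?case
      using Cons by simp
  qed simp
  have tgts: "map tgt (E p q b # map f s) = q # map tgt s"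
    by (simp add: f)
  have star: "star (E p q b # map f s)"
    unfolding star_def
  proof (intro conjI)
    have "tgt x \<noteq> p" if "x \<in> set s" for x
      using that assms(2) by auto
    then show "E p q b # map f s \<in> lists X"
      using star_lists[OF assms(1)] assms f_in by auto
    show "distinct (map tgt (E p q b # map f s))"
      unfolding tgts using assms by (auto simp: star_def)
    have "tgt ` set (E p q b # map f s) = insert q (tgt ` set s)"
      using arg_cong[OF tgts, of set] by (simp only: set_map list.set)
    moreover have "src ` set (E p q b # map f s) \<subseteq> insert p (src ` set s - {q})"
    proof (rule image_subsetI)
      fix z assume "z \<in> set (E p q b # map f s)"
      then consider "z = E p q b" | x where "x \<in> set s" "z = f x" by auto
      then show "src z \<in> insert p (src ` set s - {q})"
        by cases (simp_all add: f(2))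
    qed
    moreover have "src ` set s \<inter> tgt ` set s = {}"
      using assms(1) by (simp add: star_def)
    ultimately show "src ` set (E p q b # map f s) \<inter> tgt ` set (E p q b # map f s) = {}"
      using assms(2,3,4) by blast
  qed
  show ?thesis
  proof (intro exI conjI)
    show "star (E p q b # map f s)" by (rule star)
    show "tgt ` set s \<subseteq> tgt ` set (E p q b # map f s)"
      using f(1) by (auto simp: image_iff)
    show "s @ [E p q b] \<approx> E p q b # map f s"
      using run[OF star_lists[OF assms(1)]] by (intro run_eqvI) simp
  qed
qed

text \<open>\<open>r\<close> and \<open>k\<close> lie in one kernel class of \<open>s\<close> with
  label quotient \<open>a\<close>. If only one of them is a target, the other is its source. If both
  are, they share a source, and \<open>rel_chain\<close> turns the extra letter followed by a star
  letter into two star letters.\<close>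

lemma star_absorb:
  assumes "star s" "E r k a \<in> X" "pos s k = pos s r" "lab s k = a \<otimes> lab s r"
  shows "run (S \<rhd> E r k a) s = run S s"
proof -
  have rk: "r \<in> I" "k \<in> I" "r \<noteq> k" "a \<in> carrier M"
    using assms by auto
  have tgtE: "\<exists>i c. E i j c \<in> set s" if "j \<in> tgt ` set s" for j
    using that by (metis imageE tgt.elims)
  show ?thesis
  proof (cases "k \<in> tgt ` set s")
    case False
    then have "pos s k = k" "lab s k = \<one>"
      using star_fix by auto
    then have "r \<in> tgt ` set s"
      using star_fix[of r s] assms(3) rk by auto
    then obtain i c where ic: "E i r c \<in> set s" using tgtE by blast
    then have "i = k" "a \<otimes> c = \<one>" and c: "c \<in> carrier M"
      using star_act[OF assms(1) ic] star_letter[OF assms(1) ic] assms \<open>pos s k = k\<close> \<open>lab s k = \<one>\<close>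
      by auto
    then have "a = inv c"
      using rk by (simp add: inv_equality)
    then have "S \<rhd> E r k a \<rhd> E k r c = S \<rhd> E k r c"
      using rk c rel_inv[of k r c S] by auto
    then show ?thesis
      using star_absorb_letter[OF assms(1) ic, of S] \<open>i = k\<close>
        star_absorb_letter[OF assms(1) ic, of "S \<rhd> E r k a"] by simp
  next
    case True
    then obtain i d where d: "E i k d \<in> set s" using tgtE by blast
    show ?thesis
    proof (cases "r \<in> tgt ` set s")
      case False
      then have "r = i" "a = d"
        using star_fix[of r s] star_act[OF assms(1) d] assms rk by auto
      then show ?thesis
        using star_absorb_letter[OF assms(1) d] by simp
    next
      case True
      then obtain i' c where c: "E i' r c \<in> set s" using tgtE by blast
      have "i' = i" "d = a \<otimes> c"
        using star_act[OF assms(1) c] star_act[OF assms(1) d] assms by auto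
      moreover have "S \<rhd> E r k a \<rhd> E i r c = S \<rhd> E i r c \<rhd> E i k (a \<otimes> c)"
        using star_letter[OF assms(1) c] star_letter[OF assms(1) d] rk \<open>i' = i\<close>
        by (intro rel_chain) auto
      ultimately show ?thesis
        using star_absorb_letter[OF assms(1) c, of "S \<rhd> E r k a"]
          star_absorb_letter[OF assms(1) c, of S] \<open>i' = i\<close>
          star_absorb_letter[OF assms(1) d, of "S \<rhd> E i r c"] by simp
    qed
  qed
qed

subsection \<open>Completeness of the relations\<close>

lemma run_eqv_trans: "u \<approx> v \<Longrightarrow> v \<approx> w \<Longrightarrow> u \<approx> w"
  by (simp add: run_eqv_def)

text \<open>The dichotomy behind both normal forms: a further letter is absorbed or realised by hole
  moves, or else it is a genuine merge of two surviving tokens and is handed back to the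
  star.\<close>

lemma star_path_snoc:
  assumes s: "star s" "h \<in> tgt ` set s" and P: "path h P x" and y: "E p q b \<in> X"
  shows "(\<exists>P' x'. path h P' x' \<and> s @ P @ [E p q b] \<approx> s @ P') \<or>
    (\<exists>p' q' b'. p' \<in> I - tgt ` set s \<and> q' \<in> I - tgt ` set s \<and> p' \<noteq> q' \<and> b' \<in> carrier M \<and>
      s @ P @ [E p q b] \<approx> (s @ [E p' q' b']) @ P)"
    (is "?A \<or> ?B")
proof -
  have pq: "p \<in> I" "q \<in> I" "p \<noteq> q" "b \<in> carrier M"
    using y by auto
  have h: "hole (run S s) h" for S
    by (rule star_hole[OF s])
  have hI: "h \<in> I"
    using star_tgt[OF s(1)] s(2) by auto
  consider "q = x" | "p = x" | "p \<noteq> x" "q \<noteq> x" by blast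
  then show ?thesis
  proof cases
    case 1
    have "s @ P @ [E p q b] \<approx> s @ P"
      using path_hole[OF P h] pq 1 by (intro run_eqvI) (simp add: hole_absorb)
    then show ?thesis
      using P by blast
  next
    case 2
    have "path h (P @ [E p q b]) q"
      using P pq 2 by (auto intro: path.intros)
    then show ?thesis
      by (intro disjI1 exI[of _ "P @ [E p q b]"] exI[of _ q]) (simp add: run_eqv_def)
  next
    case 3
    obtain p' q' b' where *: "p' \<in> I - {h}" "q' \<in> I - {h}" "p' \<noteq> q'" "b' \<in> carrier M"
      "\<And>S. hole S h \<Longrightarrow> run S P \<rhd> E p q b = run (S \<rhd> E p' q' b') P"
      using path_push[OF P hI pq(1-3) 3 pq(4)] by auto
    have push: "s @ P @ [E p q b] \<approx> (s @ [E p' q' b']) @ P"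
      using *(5)[OF h] by (intro run_eqvI) simp
    consider "q' \<in> tgt ` set s" | "q' \<notin> tgt ` set s" "p' \<notin> tgt ` set s"
      | "q' \<notin> tgt ` set s" "p' \<in> tgt ` set s" by blast
    then show ?thesis
    proof cases
      case 1
      have "s @ [E p' q' b'] \<approx> s"
        using star_hole[OF s(1) 1] * by (intro run_eqvI) (simp add: hole_absorb)
      then have "s @ P @ [E p q b] \<approx> s @ P"
        using push by (simp add: run_eqv_def)
      then show ?thesis
        using P by blast
    next
      case 2
      then show ?thesis
        using * push by - (rule disjI2, rule exI[of _ p'], rule exI[of _ q'], rule exI[of _ b'], simp)
    next
      case 3
      \<comment> \<open>With an untracked hole \<open>p'\<close> as source, the letter is a move
        rather than a merge. The tracked hole performs it on a tour: the token of \<open>q'\<close>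
        waits at \<open>h\<close> and then enters \<open>p'\<close>.\<close>
      let ?L = "(([] @ [E h q' b']) @ [E q' p' \<one>]) @ [E p' h \<one>]"
      have "path h ?L h"
        using * hI by (intro path.intros) auto
      then have "path h (?L @ P) x"
        by (rule path_append[OF P])
      moreover have "s @ [E p' q' b'] \<approx> s @ ?L"
      proof (rule run_eqvI)
        fix S
        let ?S = "run S s"
        have p': "hole ?S p'" by (rule star_hole[OF s(1) 3(2)])
        have "?S \<rhd> E h q' b' \<rhd> E q' p' \<one> \<rhd> E p' h \<one> = ?S \<rhd> E h q' b' \<rhd> E p' h \<one>"
          using hole_keep[OF p', of h q' b'] * hI by (simp add: hole_absorb)
        also have "\<dots> = ?S \<rhd> E p' h \<one> \<rhd> E p' q' (b' \<otimes> \<one>)"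
          using * hI by (intro rel_chain) auto
        also have "\<dots> = ?S \<rhd> E p' q' b'"
          using h[of S] * by (simp add: hole_absorb)
        finally show "run S (s @ [E p' q' b']) = run S (s @ ?L)" by simp
      qed
      then have "s @ P @ [E p q b] \<approx> s @ ?L @ P"
        using push by (simp add: run_eqv_def)
      ultimately show ?thesis by blast
    qed
  qed
qed

lemma star_path_form:
  assumes "w \<in> lists X" "w \<noteq> []"
  shows "\<exists>s h P x. star s \<and> h \<in> tgt ` set s \<and> path h P x \<and> w \<approx> s @ P"
  using assms
proof (induction w rule: rev_induct)
  case (snoc y w)
  obtain p q b where y: "y = E p q b" by (cases y)
  have yX: "E p q b \<in> X" using snoc.prems y by simp
  show ?case
  proof (cases "w = []")
    case True
    then have "star [y]"
      using yX y by (simp add: star_def)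
    moreover have "path q [] q"
      by (rule path_Nil)
    ultimately show ?thesis
      using True y
      by (intro exI[of _ "[y]"], intro exI[of _ q], intro exI[of _ "[]"]) (auto simp: run_eqv_def)
  next
    case False
    have "w \<in> lists X"
      using snoc.prems by simp
    from snoc.IH[OF this False] obtain s h P x
      where IH: "star s" "h \<in> tgt ` set s" "path h P x" "w \<approx> s @ P" by blast
    have w: "w @ [y] \<approx> s @ P @ [E p q b]"
      using IH(4) y by (simp add: run_eqv_def)
    from star_path_snoc[OF IH(1-3) yX] show ?thesis
    proof (elim disjE exE conjE)
      fix P' x' assume "path h P' x'" "s @ P @ [E p q b] \<approx> s @ P'"
      then show ?thesis
        using IH(1,2) run_eqv_trans[OF w] by blast
    next
      fix p' q' b' assume *: "p' \<in> I - tgt ` set s" "q' \<in> I - tgt ` set s" "p' \<noteq> q'"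
        "b' \<in> carrier M" "s @ P @ [E p q b] \<approx> (s @ [E p' q' b']) @ P"
      from star_merge[OF IH(1) this(1-4)] obtain s' where s': "star s'"
        "tgt ` set s \<subseteq> tgt ` set s'" "s @ [E p' q' b'] \<approx> s'" by blast
      have "w @ [y] \<approx> s' @ P"
        using w *(5) s'(3) by (simp add: run_eqv_def)
      then show ?thesis
        using s' IH by blast
    qed
  qed
qed simp

text \<open>Here the star stays fixed and a genuine merge is reported as a collision. Excluding
  collisions by the action lets the star of one word serve another.\<close>

lemma star_append:
  assumes s: "star s" "h \<in> tgt ` set s" and w: "w \<in> lists X"
  shows "(\<exists>P x. path h P x \<and> s @ w \<approx> s @ P) \<or>
    (\<exists>p\<in>I - tgt ` set s. \<exists>q\<in>I - tgt ` set s. p \<noteq> q \<and> pos (s @ w) p = pos (s @ w) q)"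
  using w
proof (induction w rule: rev_induct)
  case Nil
  show ?case
    by (intro disjI1 exI[of _ "[]"] exI[of _ h]) (auto simp: run_eqv_def intro: path_Nil)
next
  case (snoc y w)
  obtain p q b where y: "y = E p q b" by (cases y)
  have yX: "E p q b \<in> X" and w: "w \<in> lists X" using snoc.prems y by auto
  from snoc.IH[OF w] show ?case
  proof (elim disjE exE conjE bexE)
    fix P x assume P: "path h P x" "s @ w \<approx> s @ P"
    then have wy: "s @ w @ [y] \<approx> s @ P @ [E p q b]"
      using y by (simp add: run_eqv_def)
    from star_path_snoc[OF s P(1) yX] show ?thesis
    proof (elim disjE exE conjE)
      fix P' x' assume "path h P' x'" "s @ P @ [E p q b] \<approx> s @ P'"
      then show ?thesis
        using run_eqv_trans[OF wy] by blast
    next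
      fix p' q' b' assume *: "p' \<in> I - tgt ` set s" "q' \<in> I - tgt ` set s" "p' \<noteq> q'"
        "b' \<in> carrier M" "s @ P @ [E p q b] \<approx> (s @ [E p' q' b']) @ P"
      have "P \<in> lists X"
        using path_lists[OF P(1)] star_tgt[OF s(1)] s(2) by auto
      moreover have "s \<noteq> []" using s by auto
      ultimately have "act_eq (s @ w @ [y]) ((s @ [E p' q' b']) @ P)"
        using run_eqv_act_eq[OF run_eqv_trans[OF wy *(5)]] star_lists[OF s(1)] w y yX *(1-4) by simp
      from act_eqD[OF this, of p'] act_eqD[OF this, of q']
      have "pos (s @ w @ [y]) p' = pos (s @ w @ [y]) q'"
        using * star_fix[of p' s] star_fix[of q' s] by auto
      then show ?thesis
        using * by blast
    qed
  next
    fix p' q' assume "p' \<in> I - tgt ` set s" "q' \<in> I - tgt ` set s" "p' \<noteq> q'"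
      "pos (s @ w) p' = pos (s @ w) q'"
    then show ?thesis
      by - (rule disjI2, rule bexI[of _ p'], rule bexI[of _ q'], simp_all)
  qed
qed

text \<open>\<open>P\<close> followed by the reverse of \<open>P'\<close> closes up to a tour that
  fixes all surviving tokens, and \<open>shuffle_trivial\<close> applies.\<close>

lemma star_path_unique:
  assumes s: "star s" "h \<in> tgt ` set s" and P: "path h P x" and P': "path h P' x'"
    and eq: "\<And>r. r \<in> I - tgt ` set s \<Longrightarrow> pos P r = pos P' r \<and> lab P r = lab P' r"
  shows "s @ P \<approx> s @ P'"
proof -
  let ?R = "I - tgt ` set s"
  have hI: "h \<in> I"
    using star_tgt[OF s(1)] s(2) by auto
  have h: "hole (run S s) h" for S
    by (rule star_hole[OF s])
  obtain Q where Q: "path x' Q h" "\<And>S. hole S h \<Longrightarrow> run S (P' @ Q) = S"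
    "\<And>S. hole S x' \<Longrightarrow> run S (Q @ P') = S"
    using path_reverse[OF P' hI] by auto
  \<comment> \<open>The paths may end in different holes. No surviving token ends at
    \<open>x'\<close>, so \<open>x'\<close> is also a hole after \<open>P\<close>, and the
    connecting letter is absorbed there.\<close>
  define J where "J = (if x = x' then [] else [E x x' \<one>])"
  have x: "x \<in> I" "x' \<in> I" and PX: "P \<in> lists X" "P' \<in> lists X"
    using path_lists[OF P hI] path_lists[OF P' hI] by auto
  then have QX: "Q \<in> lists X" and JX: "J \<in> lists X"
    using path_lists[OF Q(1)] by (auto simp: J_def)
  have "path x J x'"
    using path_snoc[OF path_Nil, of x' x \<one>] x by (auto simp: J_def intro: path_Nil)
  then have PJ: "path h (P @ J) x'"
    using path_append[OF _ P] by blast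
  then have "path h ((P @ J) @ Q) h"
    by (rule path_append[OF Q(1)])
  from path_shuffle[OF this hI] obtain w where w: "shuffle h (I - {h}) w"
    "\<And>S. hole S h \<Longrightarrow> run S ((P @ J) @ Q) = run S w"
    by auto
  have wX: "w \<in> lists X"
    using shuffle_lists[OF w(1) hI] by simp
  have sX: "s \<in> lists X" "s \<noteq> []"
    using star_lists s by auto
  have loop: "s @ (P @ J) @ Q \<approx> s @ w"
    using w(2)[OF h] by (intro run_eqvI) simp
  have avoid: "pos P r \<noteq> x'" if "r \<in> ?R" for r
    using eq[OF that] path_pos_neq[OF P', of r] that s(2) by auto
  have "pos w r = r \<and> lab w r = \<one>" if r: "r \<in> ?R" for r
  proof -
    have fix_s: "pos s r = r" "lab s r = \<one>"
      using star_fix[of r s] r by auto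
    have "s @ P' @ Q \<approx> s"
      using Q(2)[OF h] by (intro run_eqvI) simp
    then have "act_eq (s @ P' @ Q) s"
      using run_eqv_act_eq[of "s @ P' @ Q" s] sX PX QX by simp
    then have 1: "pos Q (pos P' r) = r \<and> lab P' r \<otimes> lab Q (pos P' r) = \<one>"
      using act_eqD[of "s @ P' @ Q" s r] r sX PX QX fix_s by simp
    have "act_eq (s @ (P @ J) @ Q) (s @ w)"
      using run_eqv_act_eq[OF loop] sX PX QX JX wX by simp
    from act_eqD[OF this, of r] have "pos w r = pos Q (pos J (pos P r)) \<and>
        lab w r = lab P r \<otimes> (lab J (pos P r) \<otimes> lab Q (pos J (pos P r)))"
      using r sX PX QX JX wX fix_s by (simp del: in_lists_conv_set)
    moreover have "pos J (pos P r) = pos P r" "lab J (pos P r) = \<one>"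
      using avoid[OF r] by (auto simp: J_def)
    ultimately show ?thesis
      using 1 eq[OF r] QX by (simp del: in_lists_conv_set)
  qed
  then have "s @ w \<approx> s"
  proof (intro shuffle_trivial[where h = h and R = ?R and Y = "tgt ` set s - {h}"])
    have "?R \<union> (tgt ` set s - {h}) = I - {h}"
      using star_tgt[OF s(1)] s(2) by auto
    then show "shuffle h (?R \<union> (tgt ` set s - {h})) w"
      using w(1) by simp
    show "hole (run S s) y" if "y \<in> tgt ` set s - {h}" for S y
      using star_hole[OF s(1)] that by simp
  qed (use sX hI h s star_tgt[OF s(1)] star_fix in \<open>auto simp: I_def\<close>)
  then have retract: "s @ (P @ J) @ Q \<approx> s"
    using loop by (rule run_eqv_trans[rotated])
  show ?thesis
  proof (rule run_eqvI)
    fix S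
    have "x' \<notin> pos P ` {r \<in> I. \<not> hole (run S s) r}"
      using avoid star_hole[OF s(1)] by blast
    then have "hole (run (run S s) P) x'"
      using path_holes[OF P h x(2)] by blast
    then have "run S (s @ P) = run S (s @ P @ J)"
      using x by (auto simp: J_def hole_absorb)
    also have "\<dots> = run (run S (s @ P @ J)) (Q @ P')"
      using Q(3)[of "run S (s @ P @ J)"] path_hole[OF PJ h] by simp
    also have "\<dots> = run S (s @ P')"
      using run_eqvD[OF retract, of S] by simp
    finally show "run S (s @ P) = run S (s @ P')" .
  qed
qed

lemma act_eq_imp_run_eqv:
  assumes u: "u \<in> lists X - {[]}" and v: "v \<in> lists X - {[]}" and uv: "act_eq u v"
  shows "u \<approx> v"
proof -
  obtain s h P x where s: "star s" "h \<in> tgt ` set s" "path h P x" "u \<approx> s @ P"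
    using star_path_form[of u] u by blast
  obtain s' h' P' x' where s': "star s'" "h' \<in> tgt ` set s'" "path h' P' x'" "v \<approx> s' @ P'"
    using star_path_form[of v] v by blast
  have hI: "h \<in> I" "h' \<in> I"
    using star_tgt[OF s(1)] s(2) star_tgt[OF s'(1)] s'(2) by auto
  have X: "P \<in> lists X" "P' \<in> lists X" "s \<in> lists X" "s' \<in> lists X" "s \<noteq> []" "s' \<noteq> []"
    using path_lists[OF s(3) hI(1)] path_lists[OF s'(3) hI(2)] star_lists s s' by auto
  have act_u: "act_eq u (s @ P)" and act_v: "act_eq v (s' @ P')"
    using run_eqv_act_eq[OF s(4) u] run_eqv_act_eq[OF s'(4) v] X by auto
  \<comment> \<open>That \<open>y # u\<close> acts like \<open>u\<close> is a condition on the
    action of \<open>u\<close> at \<open>r\<close> and \<open>k\<close> only, so it transfers to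
    \<open>v\<close>.\<close>
  have absorb: "y # v \<approx> v" if y: "y \<in> set s" for y
  proof -
    obtain r k a where y': "y = E r k a" by (cases y)
    have rk: "r \<in> I" "k \<in> I" "r \<noteq> k" "a \<in> carrier M"
      using star_letter[OF s(1)] y y' by auto
    have "y # u \<approx> u"
      using star_absorb_letter[OF s(1) y] run_eqvD[OF s(4)] by (intro run_eqvI) simp
    then have "act_eq (y # u) u"
      using run_eqv_act_eq[of "y # u" u] u y' rk by simp
    from act_eqD[OF this, of k] have "pos v k = pos v r" "lab v k = a \<otimes> lab v r"
      using y' rk act_eqD[OF uv, of k] act_eqD[OF uv, of r] by auto
    then have "pos (s' @ P') k = pos (s' @ P') r" "lab (s' @ P') k = a \<otimes> lab (s' @ P') r"
      using act_eqD[OF act_v, of k] act_eqD[OF act_v, of r] rk by auto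
    then have *: "pos P' (pos s' k) = pos P' (pos s' r)"
      "lab s' k \<otimes> lab P' (pos s' k) = a \<otimes> (lab s' r \<otimes> lab P' (pos s' r))"
      using X by (auto simp del: in_lists_conv_set)
    \<comment> \<open>\<open>P'\<close> is injective away from \<open>h'\<close>, so the coincidence
      under \<open>s' @ P'\<close> already occurs under \<open>s'\<close>; the labels contributed by
      \<open>P'\<close> then cancel.\<close>
    have "pos s' k \<noteq> h'" "pos s' r \<noteq> h'"
      using star_pos[OF s'(1), of k] star_pos[OF s'(1), of r] rk s'(2) by auto
    then have "pos s' k = pos s' r"
      using path_inj[OF s'(3)] *(1) by blast
    moreover from this have "lab s' k = a \<otimes> lab s' r"
      using *(2) X rk by (simp add: m_assoc[symmetric] del: in_lists_conv_set)
    ultimately have "run (S \<rhd> y) s' = run S s'" for S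
      using star_absorb[OF s'(1), of r k a S] y' rk by simp
    then show ?thesis
      using run_eqvD[OF s'(4)] by (intro run_eqvI) simp
  qed
  have "t @ v \<approx> v" if "set t \<subseteq> set s" for t
    using that
  proof (induction t)
    case (Cons y t)
    then have "t @ v \<approx> v" "y # v \<approx> v"
      using absorb by auto
    then show ?case
      by (simp add: run_eqv_def)
  qed (simp add: run_eqv_def)
  then have sv: "s @ v \<approx> v" by simp
  have act_sv: "act_eq (s @ v) (s @ P)"
    using run_eqv_act_eq[OF sv] v X act_eq_sym[OF uv] act_u act_eq_trans by auto
  have "\<not> (\<exists>p\<in>I - tgt ` set s. \<exists>q\<in>I - tgt ` set s. p \<noteq> q \<and> pos (s @ v) p = pos (s @ v) q)"
  proof clarify
    fix p q assume pq: "p \<in> I" "p \<notin> tgt ` set s" "q \<in> I" "q \<notin> tgt ` set s" "p \<noteq> q"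
      "pos (s @ v) p = pos (s @ v) q"
    then have "pos P p = pos P q"
      using act_eqD[OF act_sv, of p] act_eqD[OF act_sv, of q] star_fix[of p s] star_fix[of q s] by auto
    then show False
      using path_inj[OF s(3), of p q] pq s(2) by auto
  qed
  then obtain P'' x'' where P'': "path h P'' x''" "s @ v \<approx> s @ P''"
    using star_append[OF s(1,2), of v] v by blast
  have P''X: "P'' \<in> lists X"
    using path_lists[OF P''(1) hI(1)] by simp
  have "act_eq (s @ v) (s @ P'')"
    using run_eqv_act_eq[OF P''(2)] v X P''X by simp
  then have "act_eq (s @ P) (s @ P'')"
    using act_eq_trans act_eq_sym act_sv by blast
  then have "pos P r = pos P'' r \<and> lab P r = lab P'' r" if "r \<in> I - tgt ` set s" for r
    using act_eqD[of "s @ P" "s @ P''" r] that star_fix[of r s] X P''X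
    by (simp del: in_lists_conv_set)
  then have "s @ P \<approx> s @ P''"
    by (rule star_path_unique[OF s(1,2,3) P''(1)])
  then show ?thesis
    using s(4) P''(2) sv by (simp add: run_eqv_def)
qed

subsection \<open>Surjectivity\<close>

definition realizable :: "(nat \<Rightarrow> nat) \<Rightarrow> (nat \<Rightarrow> 'm) \<Rightarrow> bool" where
  "realizable f g \<longleftrightarrow> (\<exists>w\<in>lists X - {[]}. \<forall>k\<in>I. pos w k = f k \<and> lab w k = g k)"

text \<open>The word is a star with one letter \<open>E (\<rho> k) k (g k)\<close> for each
  \<open>k\<close> outside \<open>R\<close>; it is nonempty because \<open>R\<close> is
  proper.\<close>

lemma realizable_retraction:
  assumes \<rho>: "\<rho> \<in> I \<rightarrow> R" "R \<subset> I"
    and f: "\<And>k. k \<in> I \<Longrightarrow> f k = \<rho> k \<and> g k \<in> carrier M" "\<And>r. r \<in> R \<Longrightarrow> f r = r \<and> g r = \<one>"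
  shows "realizable f g"
proof -
  define ks where "ks = sorted_list_of_set (I - R)"
  have ks: "set ks = I - R" "distinct ks"
    by (auto simp: ks_def)
  define w where "w = map (\<lambda>k. E (\<rho> k) k (g k)) ks"
  have tgts: "map tgt w = ks"
    by (simp add: w_def comp_def)
  have \<rho>k: "\<rho> k \<in> R" "\<rho> k \<in> I" "\<rho> k \<noteq> k" "g k \<in> carrier M" if "k \<in> I - R" for k
    using funcset_mem[OF \<rho>(1), of k] \<rho>(2) f(1)[of k] that by auto
  have wX: "w \<in> lists X"
    using \<rho>k ks(1) by (auto simp: w_def)
  have T: "tgt ` set w = I - R"
    using arg_cong[OF tgts, of set] ks by simp
  have "src ` set w \<subseteq> R"
    using \<rho>k(1) ks(1) by (auto simp: w_def)
  then have "star w"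
    unfolding star_def T tgts using wX ks by blast
  have "pos w k = f k \<and> lab w k = g k" if "k \<in> I" for k
  proof (cases "k \<in> R")
    case True
    then show ?thesis
      using star_fix[of k w] f T by auto
  next
    case False
    then have "E (\<rho> k) k (g k) \<in> set w"
      using that ks(1) by (auto simp: w_def)
    then show ?thesis
      using star_act[OF \<open>star w\<close>] f that by auto
  qed
  moreover have "w \<noteq> []"
    using T \<rho>(2) by auto
  ultimately show ?thesis
    using wX by (auto simp: realizable_def)
qed

text \<open>Run backwards: a final letter \<open>E q h (inv b)\<close> takes what stands at
  \<open>h\<close> to \<open>q\<close> and removes \<open>b\<close> from its label. As
  \<open>f\<close> misses \<open>h\<close>, redirecting \<open>q\<close> to \<open>h\<close> creates
  no new collision.\<close>

lemma realizable_move: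
  assumes "h \<in> I" "h \<notin> f ` I" "q \<in> I" "q \<noteq> h" "b \<in> carrier M" "\<And>k. k \<in> I \<Longrightarrow> g k \<in> carrier M"
    and "realizable (\<lambda>k. if f k = q then h else f k) (\<lambda>k. if f k = q then g k \<otimes> b else g k)"
  shows "realizable f g"
proof -
  obtain w where w: "w \<in> lists X" "\<And>k. k \<in> I \<Longrightarrow> pos w k = (if f k = q then h else f k)"
    "\<And>k. k \<in> I \<Longrightarrow> lab w k = (if f k = q then g k \<otimes> b else g k)"
    using assms(7) by (auto simp: realizable_def)
  let ?e = "[E q h (inv b)]"
  have e: "?e \<in> lists X"
    using assms by simp
  have "pos (w @ ?e) k = f k \<and> lab (w @ ?e) k = g k" if "k \<in> I" for k
  proof -
    have "f k \<noteq> h" using assms(2) that by auto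
    then show ?thesis
      using w(2,3)[OF that] lab_append[OF w(1) e, of k] assms(4,5) assms(6)[OF that]
      by (simp add: m_assoc)
  qed
  then show ?thesis
    using w(1) e unfolding realizable_def by (intro bexI[of _ "w @ ?e"]) auto
qed

text \<open>
  A singular map is carried by hole moves to one that fixes every representative of its kernel
  classes with trivial label; each representative in turn takes its place, after its occupant, if
  any, has moved into a hole.
\<close>

lemma realizable_of_retraction:
  assumes \<rho>: "\<rho> \<in> I \<rightarrow> R" "R \<subset> I" "\<And>r. r \<in> R \<Longrightarrow> \<rho> r = r"
    and f: "\<And>k. k \<in> I \<Longrightarrow> f k \<in> I \<and> g k \<in> carrier M \<and> f k = f (\<rho> k)" "inj_on f R"
  shows "realizable f g"
  using f
proof (induction "card {r \<in> R. f r \<noteq> r \<or> g r \<noteq> \<one>}" arbitrary: f g rule: less_induct)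
  case less
  have RI: "R \<subseteq> I" and finR: "finite R"
    using \<rho>(2) finite_subset[of R I] by auto
  have in_R: "\<rho> k \<in> R" if "k \<in> I" for k
    using \<rho>(1) that by auto
  show ?case
  proof (cases "{r \<in> R. f r \<noteq> r \<or> g r \<noteq> \<one>} = {}")
    case True
    then have "f k = \<rho> k" if "k \<in> I" for k
      using less.prems(1)[OF that] in_R[OF that] by auto
    then show ?thesis
      using True less.prems \<rho> by (intro realizable_retraction[of \<rho> R]) auto
  next
    case False
    then obtain r where r: "r \<in> R" "f r \<noteq> r \<or> g r \<noteq> \<one>" by blast
    \<comment> \<open>If \<open>r\<close> is unoccupied, its representative moves home and
      \<open>inv (g' r)\<close> clears its label in the same move, so fewer representatives are
      misplaced.\<close>
    have place: "realizable f' g'"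
      if f': "\<And>k. k \<in> I \<Longrightarrow> f' k \<in> I \<and> g' k \<in> carrier M \<and> f' k = f' (\<rho> k)" "inj_on f' R"
        and bad: "\<And>k. k \<in> R \<Longrightarrow> f k = k \<and> g k = \<one> \<Longrightarrow> f' k = k \<and> g' k = \<one>"
        and free: "r \<notin> f' ` I" for f' g'
    proof (rule realizable_move[of r f' "f' r" "inv (g' r)"])
      let ?f = "\<lambda>k. if f' k = f' r then r else f' k"
      let ?g = "\<lambda>k. if f' k = f' r then g' k \<otimes> inv (g' r) else g' k"
      have rI: "r \<in> I" using r RI by auto
      have r': "f' r \<in> I" "g' r \<in> carrier M" "f' r \<noteq> r"
        using f'(1)[OF rI] free rI by (blast, blast, metis image_eqI)
      show "r \<in> I" "r \<notin> f' ` I" "f' r \<in> I" "f' r \<noteq> r" "inv (g' r) \<in> carrier M"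
        using rI r' free by simp_all
      show "g' k \<in> carrier M" if "k \<in> I" for k
        using f' that by blast
      have "?f r = r \<and> ?g r = \<one>"
        using r' by simp
      moreover have "?f k = k \<and> ?g k = \<one>" if "k \<in> R" "f k = k \<and> g k = \<one>" for k
        using bad[OF that] r inj_onD[OF f'(2), of k r] that by auto
      ultimately have "{k \<in> R. ?f k \<noteq> k \<or> ?g k \<noteq> \<one>} \<subset> {k \<in> R. f k \<noteq> k \<or> g k \<noteq> \<one>}"
        using r by blast
      then have less_card: "card {k \<in> R. ?f k \<noteq> k \<or> ?g k \<noteq> \<one>} < card {k \<in> R. f k \<noteq> k \<or> g k \<noteq> \<one>}"
        using finR by (intro psubset_card_mono) auto
      have 1: "?f k \<in> I \<and> ?g k \<in> carrier M \<and> ?f k = ?f (\<rho> k)" if "k \<in> I" for k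
      proof -
        have "f' k \<in> I" "g' k \<in> carrier M" "f' (\<rho> k) = f' k"
          using f'(1)[OF that] by auto
        then show ?thesis using r' rI by simp
      qed
      have 2: "inj_on ?f R"
      proof (rule inj_onI)
        fix k l assume kl: "k \<in> R" "l \<in> R" "?f k = ?f l"
        have "f' k \<noteq> r" "f' l \<noteq> r"
          using free kl RI by auto
        then have "f' k = f' l"
          using kl(3) by (auto split: if_splits)
        then show "k = l"
          using inj_onD[OF f'(2)] kl by blast
      qed
      show "realizable ?f ?g"
        by (rule less.hyps[OF less_card 1 2])
    qed
    show ?thesis
    proof (cases "r \<in> f ` I")
      case False
      then show ?thesis
        by (intro place less.prems) auto
    next
      case True
      \<comment> \<open>The image is no larger than the proper subset \<open>R\<close>, so some
        \<open>h\<close> is free to receive the occupant of \<open>r\<close>. The occupant may be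
        the class of \<open>r\<close> itself, at home with a wrong label.\<close>
      have "f ` I \<subseteq> f ` R"
        using less.prems(1) in_R by (metis image_eqI image_subsetI)
      then have "card (f ` I) < card I"
        using card_mono[of "f ` R" "f ` I"] card_image_le[of R f] psubset_card_mono[of I R] \<rho>(2) finR
        by simp
      moreover have "f ` I \<subseteq> I"
        using less.prems(1) by blast
      ultimately have "f ` I \<noteq> I" by auto
      then obtain h where h: "h \<in> I" "h \<notin> f ` I"
        using \<open>f ` I \<subseteq> I\<close> by blast
      then have hr: "r \<noteq> h" using True by auto
      let ?f = "\<lambda>k. if f k = r then h else f k"
      let ?g = "\<lambda>k. if f k = r then g k \<otimes> \<one> else g k"
      have fk: "f k \<noteq> h" if "k \<in> I" for k
        using h that by auto
      show ?thesis
      proof (rule realizable_move[of h f r \<one>])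
        show "h \<in> I" "h \<notin> f ` I" "r \<in> I" "r \<noteq> h" "\<one> \<in> carrier M"
          using h hr r RI by auto
        show "g k \<in> carrier M" if "k \<in> I" for k
          using less.prems that by blast
        show "realizable ?f ?g"
        proof (rule place)
          show "?f k \<in> I \<and> ?g k \<in> carrier M \<and> ?f k = ?f (\<rho> k)" if "k \<in> I" for k
          proof -
            have "f k \<in> I" "g k \<in> carrier M" "f (\<rho> k) = f k"
              using less.prems(1)[OF that] by auto
            then show ?thesis using h(1) by simp
          qed
          show "inj_on ?f R"
          proof (rule inj_onI)
            fix k l assume kl: "k \<in> R" "l \<in> R" "?f k = ?f l"
            then have "f k = f l"
              using fk[of k] fk[of l] RI by (auto split: if_splits)
            then show "k = l"
              using inj_onD[OF less.prems(2)] kl by blast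
          qed
          show "?f k = k \<and> ?g k = \<one>" if "k \<in> R" "f k = k \<and> g k = \<one>" for k
            using that r by auto
          show "r \<notin> ?f ` I"
            using hr by auto
        qed
      qed
    qed
  qed
qed

text \<open>\<open>\<rho>\<close> selects one representative in each fibre of \<open>f\<close>;
  non-injectivity makes the set of representatives proper.\<close>

lemma realizable_singular:
  assumes "\<And>k. k \<in> I \<Longrightarrow> f k \<in> I \<and> g k \<in> carrier M" "\<not> inj_on f I"
  shows "realizable f g"
proof -
  define \<rho> where "\<rho> = (\<lambda>k. inv_into I f (f k))"
  have \<rho>: "\<rho> k \<in> I" "f (\<rho> k) = f k" if "k \<in> I" for k
    using that by (auto simp: \<rho>_def f_inv_into_f inv_into_into)
  have inj: "inj_on f (\<rho> ` I)"
  proof (rule inj_onI)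
    fix x y assume "x \<in> \<rho> ` I" "y \<in> \<rho> ` I" "f x = f y"
    then show "x = y"
      using \<rho>(2) by (auto simp: \<rho>_def)
  qed
  show ?thesis
  proof (rule realizable_of_retraction[of \<rho> "\<rho> ` I"])
    show "\<rho> ` I \<subset> I"
      using \<rho>(1) inj assms(2) by (metis image_subsetI psubsetI)
    show "\<rho> r = r" if "r \<in> \<rho> ` I" for r
      using that \<rho>(2) by (auto simp: \<rho>_def)
  qed (use assms(1) \<rho> inj in auto)
qed

subsection \<open>The presentation\<close>

lemma Sing_eq: "Sing n = {\<alpha> \<in> I \<rightarrow>\<^sub>E I. \<not> inj_on \<alpha> I}"
proof -
  have "bij_betw \<alpha> I I \<longleftrightarrow> inj_on \<alpha> I" if "\<alpha> \<in> I \<rightarrow>\<^sub>E I" for \<alpha>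
    using that endo_inj_surj[of I \<alpha>] by (auto simp: bij_betw_def)
  then show ?thesis
    unfolding Sing_def full_transf_def I_def[symmetric] by blast
qed

lemma wreath_Sing_carrier: "carrier (wreath_Sing M n) = (I \<rightarrow>\<^sub>E carrier M) \<times> Sing n"
  by (simp add: wreath_Sing_def I_def)

lemma wreath_Sing_mult:
  "(a, \<alpha>) \<otimes>\<^bsub>wreath_Sing M n\<^esub> (b, \<beta>) = (\<lambda>k\<in>I. a k \<otimes> b (\<alpha> k), compose I \<beta> \<alpha>)"
  by (simp add: wreath_Sing_def I_def)

lemma semigroup_wreath_Sing: "semigroup_str (wreath_Sing M n)"
  unfolding semigroup_str_def
proof (intro conjI ballI)
  fix x y assume xy: "x \<in> carrier (wreath_Sing M n)" "y \<in> carrier (wreath_Sing M n)"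
  obtain a \<alpha> b \<beta> where x: "x = (a, \<alpha>)" and y: "y = (b, \<beta>)" by (metis prod.exhaust)
  have ab: "a \<in> I \<rightarrow>\<^sub>E carrier M" "b \<in> I \<rightarrow>\<^sub>E carrier M" "\<alpha> \<in> I \<rightarrow>\<^sub>E I" "\<beta> \<in> I \<rightarrow>\<^sub>E I" "\<not> inj_on \<alpha> I"
    using xy by (auto simp: x y wreath_Sing_carrier Sing_eq)
  then obtain k l where "k \<in> I" "l \<in> I" "k \<noteq> l" "\<alpha> k = \<alpha> l"
    by (auto simp: inj_on_def)
  then have "\<not> inj_on (compose I \<beta> \<alpha>) I"
    by (metis compose_eq inj_onD)
  moreover have "compose I \<beta> \<alpha> \<in> I \<rightarrow>\<^sub>E I" "(\<lambda>k\<in>I. a k \<otimes> b (\<alpha> k)) \<in> I \<rightarrow>\<^sub>E carrier M"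
    using ab(1-4) by (auto simp: compose_def)
  ultimately show "x \<otimes>\<^bsub>wreath_Sing M n\<^esub> y \<in> carrier (wreath_Sing M n)"
    by (simp add: x y wreath_Sing_carrier wreath_Sing_mult Sing_eq)
next
  fix x y z assume xyz: "x \<in> carrier (wreath_Sing M n)" "y \<in> carrier (wreath_Sing M n)"
    "z \<in> carrier (wreath_Sing M n)"
  obtain a \<alpha> b \<beta> c \<gamma> where e: "x = (a, \<alpha>)" "y = (b, \<beta>)" "z = (c, \<gamma>)" by (metis prod.exhaust)
  have "a k \<in> carrier M" "b k \<in> carrier M" "c k \<in> carrier M" "\<alpha> k \<in> I" "\<beta> k \<in> I" if "k \<in> I" for k
    using that xyz by (auto simp: e wreath_Sing_carrier Sing_eq)
  then show "x \<otimes>\<^bsub>wreath_Sing M n\<^esub> y \<otimes>\<^bsub>wreath_Sing M n\<^esub> z =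
      x \<otimes>\<^bsub>wreath_Sing M n\<^esub> (y \<otimes>\<^bsub>wreath_Sing M n\<^esub> z)"
    by (simp add: e wreath_Sing_mult compose_def fun_eq_iff m_assoc)
qed

lemma phi1_epi: "phi1 M n \<in> epi (free_semigroup X) (wreath_Sing M n)"
proof -
  let ?F = "free_semigroup X" and ?W = "wreath_Sing M n"
  have in_carrier: "phi1 M n w \<in> carrier ?W" if w: "w \<in> carrier ?F" for w
  proof -
    have wX: "w \<in> lists X" "w \<noteq> []"
      using w by (auto simp: carrier_free_semigroup)
    obtain x w' where "w = x # w'"
      using wX(2) by (cases w) auto
    moreover obtain i j a where "x = E i j a" by (cases x)
    \<comment> \<open>The first letter \<open>E i j a\<close> already identifies \<open>i\<close>
      and \<open>j\<close>.\<close>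
    ultimately have ij: "i \<in> I" "j \<in> I" "i \<noteq> j" "pos w i = pos w j"
      using wX by auto
    have "\<not> inj_on (restrict (pos w) I) I"
    proof
      assume "inj_on (restrict (pos w) I) I"
      from inj_onD[OF this, of i j] ij show False by simp
    qed
    moreover have "restrict (pos w) I \<in> I \<rightarrow>\<^sub>E I" "restrict (lab w) I \<in> I \<rightarrow>\<^sub>E carrier M"
      using pos_closed[OF wX(1)] lab_closed[OF wX(1)] by (auto simp: restrict_PiE_iff)
    ultimately show ?thesis
      unfolding phi1_eq[OF wX] wreath_Sing_carrier Sing_eq by simp
  qed
  have mult: "phi1 M n (u @ v) = phi1 M n u \<otimes>\<^bsub>?W\<^esub> phi1 M n v"
    if "u \<in> carrier ?F" "v \<in> carrier ?F" for u v
  proof -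
    have uv: "u \<in> lists X" "u \<noteq> []" "v \<in> lists X" "v \<noteq> []"
      using that by (auto simp: carrier_free_semigroup)
    then have "u @ v \<in> lists X" "u @ v \<noteq> []" by auto
    then show ?thesis
      unfolding phi1_eq[OF uv(1,2)] phi1_eq[OF uv(3,4)] wreath_Sing_mult
      using uv by (simp add: phi1_eq compose_def fun_eq_iff del: in_lists_conv_set)
  qed
  have surj: "\<exists>w\<in>carrier ?F. phi1 M n w = x" if x: "x \<in> carrier ?W" for x
  proof -
    obtain g f where x': "x = (g, f)" by (cases x)
    have gf: "g \<in> I \<rightarrow>\<^sub>E carrier M" "f \<in> I \<rightarrow>\<^sub>E I" "\<not> inj_on f I"
      using x x' by (auto simp: wreath_Sing_carrier Sing_eq)
    then have "realizable f g"
      by (intro realizable_singular) auto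
    then obtain w where w: "w \<in> lists X" "w \<noteq> []" "\<And>k. k \<in> I \<Longrightarrow> pos w k = f k \<and> lab w k = g k"
      unfolding realizable_def by blast
    have "restrict (lab w) I k = g k \<and> restrict (pos w) I k = f k" for k
      using w(3)[of k] PiE_arb[OF gf(1), of k] PiE_arb[OF gf(2), of k] by (cases "k \<in> I") simp_all
    then have "restrict (lab w) I = g" "restrict (pos w) I = f"
      by (simp_all add: fun_eq_iff)
    then have "phi1 M n w = x"
      using phi1_eq[OF w(1,2)] x' by simp
    then show ?thesis
      using w(1,2) by (intro bexI[of _ w]) (simp_all add: carrier_free_semigroup)
  qed
  have "u \<otimes>\<^bsub>?F\<^esub> v = u @ v" for u v
    by (simp add: free_semigroup_def)
  then have "phi1 M n \<in> hom ?F ?W"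
    using in_carrier mult by (intro homI) simp_all
  moreover have "phi1 M n ` carrier ?F = carrier ?W"
  proof
    show "phi1 M n ` carrier ?F \<subseteq> carrier ?W"
      by (rule image_subsetI) (rule in_carrier)
    show "carrier ?W \<subseteq> phi1 M n ` carrier ?F"
      using surj by blast
  qed
  ultimately show ?thesis
    by (simp add: epi_def)
qed

lemma hom_kernel_eq: "hom_kernel (free_semigroup X) (phi1 M n) = cong_rel"
proof
  show "hom_kernel (free_semigroup X) (phi1 M n) \<subseteq> cong_rel"
  proof clarify
    fix u v assume "(u, v) \<in> hom_kernel (free_semigroup X) (phi1 M n)"
    then have uv: "u \<in> lists X - {[]}" "v \<in> lists X - {[]}" "phi1 M n u = phi1 M n v"
      by (auto simp: hom_kernel_def carrier_free_semigroup)
    then have "u \<approx> v"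
      using act_eq_imp_run_eqv phi1_eq_iff by blast
    then show "(u, v) \<in> cong_rel"
      using run_eqv_cong_rel uv by blast
  qed
qed (rule cong_rel_sound)

end

theorem theorem5p12:
  fixes M :: "('m, 'b) monoid_scheme" and n :: nat
  assumes "n \<ge> 2" and "group M"
  shows "has_semigroup_presentation (wreath_Sing M n) (X1 M n) (R1' M n) (phi1 M n)"
proof -
  interpret wreath M n
    using assms(2) by (rule wreath.intro)
  show ?thesis
    unfolding has_semigroup_presentation_def
    using semigroup_wreath_Sing R1'_subset phi1_epi hom_kernel_eq by blast
qed

end
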